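(* Let $\{(X_n,Y_n): n\ge 1\}$ be a sequence of random pairs of nonnegative integers, each taking values in a bounded set, such that for each $n$ the bivariate probability generating polynomial $f_n(x,y)=\sum_{r,s}\mathbb{P}(X_n=r,Y_n=s)x^ry^s$ is real stable and has degree at most $M_n$ in each variable. Let $$A_n=\begin{pmatrix}\alpha_n & -\beta_n\\ -\beta_n & \gamma_n\end{pmatrix}$$ denote the covariance matrix of $(X_n,Y_n)$. Suppose there is a sequence $s_n\to\infty$ and a fixed matrix $$A=\begin{pmatrix}\alpha & -\beta\\ -\beta & \gamma\end{pmatrix}$$ such that $s_n^{-2}A_n\to A$ and $s_n^{-1}M_n^{1/3}\to 0$ as $n\to\infty$. Then $$\frac{(X_n,Y_n)-(\mathbb{E}X_n,\mathbb{E}Y_n)}{s_n}\to N(0,A)$$ in distribution as $n\to\infty$.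
   Context: A polynomial $f$ in $d$ complex variables with real coefficients is real stable if it has no zeros in $\mathbb{H}^d$, where $\mathbb{H}=\{z\in\mathbb{C}:\Im z>0\}$ is the open upper half plane. $N(0,A)$ denotes the centered Gaussian law with covariance matrix $A$, which may be degenerate (if $A$ is singular). *)

theory Defs
  imports "HOL-Probability.Probability" "HOL-Computational_Algebra.Polynomial"
begin

section \<open>Bivariate polynomials\<close>

text \<open>
  A bivariate real polynomial is an element of \<open>\<real>[y][x]\<close>, of type \<^typ>\<open>real poly poly\<close>:
  the coefficient of \<open>x\<^sup>r y\<^sup>s\<close> in \<open>f\<close> is \<open>coeff (coeff f r) s\<close>, so \<open>degree f\<close> is
  the degree of \<open>f\<close> in \<open>x\<close>.
\<close>

definition ceval2 :: "real poly poly \<Rightarrow> complex \<Rightarrow> complex \<Rightarrow> complex" where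
  "ceval2 f x y = poly (map_poly (\<lambda>c. poly (map_poly complex_of_real c) y) f) x"

definition degree_y :: "real poly poly \<Rightarrow> nat" where
  "degree_y f = (MAX r\<in>{..degree f}. degree (coeff f r))"

definition real_stable2 :: "real poly poly \<Rightarrow> bool" where
  "real_stable2 f \<longleftrightarrow> (\<forall>x y. Im x > 0 \<longrightarrow> Im y > 0 \<longrightarrow> ceval2 f x y \<noteq> 0)"

text \<open>The sums below are meaningful only when \<open>U\<close> and \<open>V\<close> are bounded on the space.\<close>

definition prob_gen_poly ::
    "'a measure \<Rightarrow> ('a \<Rightarrow> nat) \<Rightarrow> ('a \<Rightarrow> nat) \<Rightarrow> real poly poly" where
  "prob_gen_poly P U V =
    (\<Sum>r\<in>U ` space P. \<Sum>s\<in>V ` space P.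
      monom (monom (measure P {\<omega> \<in> space P. U \<omega> = r \<and> V \<omega> = s}) s) r)"

section \<open>Random vectors, Gaussian laws and convergence in distribution\<close>

definition covariance_matrix :: "'a measure \<Rightarrow> ('a \<Rightarrow> real ^ 'n) \<Rightarrow> real ^ 'n ^ 'n" where
  "covariance_matrix P Z =
    (\<chi> i j. \<integral>\<omega>. (Z \<omega> $ i - (\<integral>\<omega>'. Z \<omega>' $ i \<partial>P)) * (Z \<omega> $ j - (\<integral>\<omega>'. Z \<omega>' $ j \<partial>P)) \<partial>P)"

definition std_gaussian :: "(real ^ 'n) measure" where
  "std_gaussian = distr (Pi\<^sub>M UNIV (\<lambda>i::'n. std_normal_distribution)) borel vec_lambda"

text \<open>
  \<open>N(0,A)\<close> is the law of \<open>B Z\<close> with \<open>Z\<close> standard Gaussian and \<open>B B\<^sup>T = A\<close>. Such a \<open>B\<close> exists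
  precisely when \<open>A\<close> is symmetric positive semidefinite, singular matrices included; for other
  \<open>A\<close> the definition is junk. By \<open>char_centered_gaussian\<close> below the characteristic function,
  and hence the law, does not depend on the choice of \<open>B\<close>.
\<close>

definition centered_gaussian :: "real ^ 'n ^ 'n \<Rightarrow> (real ^ 'n) measure" where
  "centered_gaussian A =
    distr std_gaussian borel (\<lambda>z. (SOME B :: real ^ 'n ^ 'n. B ** transpose B = A) *v z)"

text \<open>
  Weak convergence for Borel measures on an arbitrary topological space, tested against bounded
  continuous functions; \<^const>\<open>weak_conv_m\<close> is restricted to the real line.
\<close>

definition weak_converges ::
    "(nat \<Rightarrow> 'b::topological_space measure) \<Rightarrow> 'b measure \<Rightarrow> bool" where
  "weak_converges \<mu> \<nu> \<longleftrightarrow>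
    (\<forall>g :: 'b \<Rightarrow> real. continuous_on UNIV g \<longrightarrow> bounded (range g) \<longrightarrow>
      (\<lambda>n. \<integral>x. g x \<partial>\<mu> n) \<longlonglongrightarrow> (\<integral>x. g x \<partial>\<nu>))"

definition converges_in_distribution ::
    "(nat \<Rightarrow> 'a measure) \<Rightarrow> (nat \<Rightarrow> 'a \<Rightarrow> 'b::topological_space) \<Rightarrow> 'b measure \<Rightarrow> bool" where
  "converges_in_distribution P Z \<nu> \<longleftrightarrow> weak_converges (\<lambda>n. distr (P n) borel (Z n)) \<nu>"

lemma measurable_vec_lambda [measurable]:
  "(vec_lambda :: ('n::finite \<Rightarrow> real) \<Rightarrow> real ^ 'n)
     \<in> borel_measurable (Pi\<^sub>M UNIV (\<lambda>i. std_normal_distribution))"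
proof (subst borel_measurable_euclidean_space, intro ballI)
  fix b :: "real ^ 'n" assume "b \<in> Basis"
  then obtain i where b: "b = axis i 1" by (auto simp: Basis_vec_def)
  have "(\<lambda>x. x i) \<in> borel_measurable (Pi\<^sub>M UNIV (\<lambda>i::'n. std_normal_distribution))"
    using measurable_component_singleton[of i UNIV "\<lambda>i::'n. std_normal_distribution"]
    by simp
  then show "(\<lambda>x. vec_lambda x \<bullet> b) \<in> borel_measurable (Pi\<^sub>M UNIV (\<lambda>i::'n. std_normal_distribution))"
    by (simp add: b inner_axis)
qed

lemma measurable_matrix_vector_mult: "(\<lambda>z::real ^ 'n. (B :: real ^ 'n ^ 'm) *v z) \<in> borel_measurable borel"
  by (intro borel_measurable_continuous_onI continuous_intros)

lemma char_centered_gaussian: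
  fixes A B :: "real ^ 'n ^ 'n" and t :: "real ^ 'n"
  assumes "B ** transpose B = A"
  shows "(\<integral>x. iexp (t \<bullet> x) \<partial>centered_gaussian A) = exp (- complex_of_real (t \<bullet> (A *v t)) / 2)"
proof -
  define C :: "real ^ 'n ^ 'n" where "C = (SOME B. B ** transpose B = A)"
  have C: "C ** transpose C = A" unfolding C_def by (rule someI[of _ B]) fact
  define u where "u = transpose C *v t"
  have ps: "prob_space std_normal_distribution"
    by (simp add: prob_space_normal_density)
  interpret product_prob_space "\<lambda>_. std_normal_distribution" "UNIV :: 'n set"
    by (intro product_prob_spaceI ps)
  have iexp_meas: "(\<lambda>x::real ^ 'n. iexp (t \<bullet> x)) \<in> borel_measurable borel"
    by measurable
  have iexp_meas': "(\<lambda>x::real ^ 'n. iexp (t \<bullet> (C *v x))) \<in> borel_measurable borel"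
    by (rule measurable_compose[OF measurable_matrix_vector_mult iexp_meas])
  have eq: "t \<bullet> (C *v z) = (\<Sum>i\<in>UNIV. u $ i * z $ i)" for z
  proof -
    have "t \<bullet> (C *v z) = u \<bullet> z" by (simp add: u_def dot_lmul_matrix)
    then show ?thesis by (simp add: inner_vec_def)
  qed
  have "(\<integral>x. iexp (t \<bullet> x) \<partial>centered_gaussian A) = (\<integral>z. iexp (t \<bullet> (C *v z)) \<partial>std_gaussian)"
    unfolding centered_gaussian_def C_def[symmetric]
    by (rule integral_distr)
       (use measurable_matrix_vector_mult[of C] iexp_meas in \<open>simp_all add: std_gaussian_def\<close>)
  also have "\<dots> = (\<integral>z. iexp (t \<bullet> (C *v vec_lambda z)) \<partial>Pi\<^sub>M UNIV (\<lambda>i::'n. std_normal_distribution))"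
    unfolding std_gaussian_def
    by (rule integral_distr[OF measurable_vec_lambda iexp_meas'])
  also have "\<dots> = (\<integral>z. (\<Prod>i\<in>UNIV. iexp (u $ i * z i)) \<partial>Pi\<^sub>M UNIV (\<lambda>i::'n. std_normal_distribution))"
    by (simp add: eq exp_sum[symmetric] sum_distrib_left)
  also have "\<dots> = (\<Prod>i\<in>UNIV. \<integral>x. iexp (u $ i * x) \<partial>std_normal_distribution)"
    by (rule product_integral_prod) (auto intro!: finite_measure.integrable_const_bound[OF prob_space.finite_measure[OF ps], where B=1])
  also have "\<dots> = (\<Prod>i\<in>UNIV. complex_of_real (exp (- ((u $ i)\<^sup>2) / 2)))"
    using char_std_normal_distribution by (simp add: char_def fun_eq_iff)
  also have "\<dots> = exp (- complex_of_real (u \<bullet> u) / 2)"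
    by (simp add: exp_of_real[symmetric] exp_sum[symmetric] inner_vec_def power2_eq_square
          sum_negf sum_divide_distrib)
  also have "u \<bullet> u = t \<bullet> (A *v t)"
    by (simp add: u_def C[symmetric] dot_lmul_matrix matrix_vector_mul_assoc[symmetric])
  finally show ?thesis .
qed

end

theory Submission
  imports Defs "HOL-Complex_Analysis.Complex_Analysis"
begin

text \<open>
  For \<open>a, b > 0\<close> real stability keeps \<open>g(u) = E exp (u (a X + b Y))\<close> free of zeros in the strip
  \<open>\<bar>Im u\<bar> < \<pi> / max a b\<close>. On a disc around 0 the logarithm of \<open>g\<close> is therefore holomorphic, and
  \<open>Re (log g) = O(M)\<close> there because the exponents are nonnegative and bounded by \<open>(a + b) M\<close>.
  Borel-Caratheodory and Cauchy's estimates make the third-order Taylor remainder of \<open>log g\<close> at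
  \<open>u\<close> of size \<open>O(M \<bar>u\<bar>\<^sup>3)\<close>, which vanishes for \<open>u = z / s\<^sub>n\<close>. So the moment generating functions
  of the normalised \<open>a X + b Y\<close> converge to the Gaussian ones at all complex arguments. The
  directions outside the two quadrants \<open>a b > 0\<close> are reached by analytic continuation along
  \<open>(1, 1)\<close>, with a normal family argument, and Levy's continuity theorem in the plane concludes.
\<close>

section \<open>Continuity theorem in Euclidean space\<close>

text \<open>Complex span of the characters: convergence of characteristic functions passes to
  integrals of exactly these functions by linearity. Frequencies add under multiplication, so the
  span is an algebra.\<close>

inductive trig_poly :: "('a::euclidean_space \<Rightarrow> complex) \<Rightarrow> bool" where
  monomial: "trig_poly (\<lambda>x. c * iexp (t \<bullet> x))"
| add: "trig_poly f \<Longrightarrow> trig_poly g \<Longrightarrow> trig_poly (\<lambda>x. f x + g x)"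

lemma trig_poly_const: "trig_poly (\<lambda>x. c)"
  using trig_poly.monomial[of c 0] by simp

lemma trig_poly_monomial_mult:
  assumes "trig_poly g"
  shows "trig_poly (\<lambda>x. (c * iexp (t \<bullet> x)) * g x)"
  using assms
proof induction
  case (monomial d u)
  have "(\<lambda>x. c * iexp (t \<bullet> x) * (d * iexp (u \<bullet> x))) = (\<lambda>x. (c * d) * iexp ((t + u) \<bullet> x))"
    by (simp add: fun_eq_iff inner_add_left distrib_left exp_add algebra_simps)
  then show ?case by (metis trig_poly.monomial)
next
  case (add f g)
  from trig_poly.add[OF add.IH] show ?case by (simp add: distrib_left)
qed

lemma trig_poly_mult:
  assumes "trig_poly f" "trig_poly g"
  shows "trig_poly (\<lambda>x. f x * g x)"
  using assms
proof induction
  case (monomial c t)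
  then show ?case by (rule trig_poly_monomial_mult)
next
  case (add f h)
  from trig_poly.add[OF add.IH[OF add.prems]] show ?case
    by (simp add: distrib_right)
qed

lemma trig_poly_cmult: "trig_poly f \<Longrightarrow> trig_poly (\<lambda>x. c * f x)"
  by (intro trig_poly_mult trig_poly_const)

lemma trig_poly_sum:
  assumes "finite I" "\<And>i. i \<in> I \<Longrightarrow> trig_poly (f i)"
  shows "trig_poly (\<lambda>x. \<Sum>i\<in>I. f i x)"
  using assms by (induction I) (auto intro: trig_poly_const trig_poly.add)

lemma trig_poly_sin: "trig_poly (\<lambda>x. complex_of_real (sin (t \<bullet> x)))"
proof -
  have "complex_of_real (sin y) = inverse (2 * \<i>) * iexp y + (- inverse (2 * \<i>)) * iexp (- y)" for y
    by (simp add: sin_of_real[symmetric] sin_exp_eq field_simps)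
  then have "complex_of_real (sin (t \<bullet> x))
      = inverse (2 * \<i>) * iexp (t \<bullet> x) + (- inverse (2 * \<i>)) * iexp ((- t) \<bullet> x)" for x
    by simp
  then show ?thesis
    by (simp only:) (intro trig_poly.intros)
qed

text \<open>Makes polynomial approximation usable: a polynomial in the sines of the coordinates is a
  trigonometric polynomial because these form an algebra containing the sines.\<close>

lemma trig_poly_real_polynomial_sin:
  fixes r :: "'a::euclidean_space \<Rightarrow> real"
  assumes "real_polynomial_function r"
  shows "trig_poly (\<lambda>x::'a. complex_of_real (r (\<Sum>b\<in>Basis. sin (c * (x \<bullet> b)) *\<^sub>R b)))"
  using assms
proof induction
  case (linear h)
  then interpret bounded_linear h .
  have sin: "trig_poly (\<lambda>x::'a. complex_of_real (sin (c * (x \<bullet> b))))" for b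
    using trig_poly_sin[of "c *\<^sub>R b"] by (simp add: inner_commute)
  have "complex_of_real (h (\<Sum>b\<in>Basis. sin (c * (x \<bullet> b)) *\<^sub>R b))
      = (\<Sum>b\<in>Basis. complex_of_real (h b) * complex_of_real (sin (c * (x \<bullet> b))))" for x :: 'a
    by (simp add: sum scaleR mult.commute)
  then show ?case
    by (simp only:) (intro trig_poly_sum trig_poly_cmult sin finite_Basis)
next
  case (const c)
  show ?case by (rule trig_poly_const)
next
  case (add f g)
  then show ?case by (simp add: trig_poly.add)
next
  case (mult f g)
  then show ?case by (simp add: trig_poly_mult)
qed

section \<open>Integrals of trigonometric polynomials\<close>

lemma trig_poly_continuous: "trig_poly f \<Longrightarrow> continuous_on UNIV f"
  by (induction rule: trig_poly.induct) (auto intro!: continuous_intros)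

lemma trig_poly_integrable:
  assumes "trig_poly f" "finite_measure M" "sets M = sets borel"
  shows "integrable M f"
  using assms(1)
proof induction
  case (monomial c t)
  have "(\<lambda>x::'a. c * iexp (t \<bullet> x)) \<in> borel_measurable borel"
    by measurable
  then have "(\<lambda>x. c * iexp (t \<bullet> x)) \<in> borel_measurable M"
    by (simp add: measurable_cong_sets[OF assms(3) refl])
  then show ?case
    by (intro finite_measure.integrable_const_bound[OF assms(2), where B = "norm c"])
       (auto simp: norm_mult)
qed simp

lemma trig_poly_integral_tendsto:
  fixes \<mu> :: "nat \<Rightarrow> 'a::euclidean_space measure"
  assumes "\<And>n. prob_space (\<mu> n)" "\<And>n. sets (\<mu> n) = sets borel"
    and "prob_space \<nu>" "sets \<nu> = sets borel"
    and char: "\<And>t. (\<lambda>n. \<integral>x. iexp (t \<bullet> x) \<partial>\<mu> n) \<longlonglongrightarrow> (\<integral>x. iexp (t \<bullet> x) \<partial>\<nu>)"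
    and "trig_poly f"
  shows "(\<lambda>n. \<integral>x. f x \<partial>\<mu> n) \<longlonglongrightarrow> (\<integral>x. f x \<partial>\<nu>)"
  using \<open>trig_poly f\<close>
proof induction
  case (monomial c t)
  then show ?case by (simp add: tendsto_mult_left[OF char])
next
  case (add f g)
  have int: "integrable (\<mu> n) h" "integrable \<nu> h" if "trig_poly h" for n h
    using that assms(1-4) by (auto intro!: trig_poly_integrable simp: prob_space.finite_measure)
  from tendsto_add[OF add.IH] add.hyps show ?case
    by (simp add: int)
qed

text \<open>The integrand difference is at most \<open>e\<close> inside the ball of radius
  \<open>K\<close> and at most \<open>B + C\<close> outside, where the mass is at most
  \<open>d\<close>.\<close>

lemma integral_diff_le_of_tight:
  fixes f g :: "'a::euclidean_space \<Rightarrow> real"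
  assumes "prob_space M" and sets: "sets M = sets borel"
    and f: "f \<in> borel_measurable borel" "\<And>x. \<bar>f x\<bar> \<le> B"
    and g: "g \<in> borel_measurable borel" "\<And>x. \<bar>g x\<bar> \<le> C"
    and close: "\<And>x. norm x \<le> K \<Longrightarrow> \<bar>f x - g x\<bar> \<le> e"
    and tail: "measure M {x. norm x > K} \<le> d" and "0 \<le> e"
  shows "\<bar>(\<integral>x. f x \<partial>M) - (\<integral>x. g x \<partial>M)\<bar> \<le> e + (B + C) * d"
proof -
  interpret prob_space M by fact
  have [simp]: "space M = UNIV" using sets_eq_imp_space_eq[OF sets] by simp
  have fM: "f \<in> borel_measurable M" "g \<in> borel_measurable M"
    using f g by (simp_all add: measurable_cong_sets[OF sets refl])
  have intf: "integrable M f" by (rule integrable_const_bound[where B = B]) (use f fM in auto)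
  have intg: "integrable M g" by (rule integrable_const_bound[where B = C]) (use g fM in auto)
  have S: "{x. norm x > K} \<in> sets M"
    unfolding sets by measurable
  have BC: "0 \<le> B" "0 \<le> C" using f(2)[of 0] g(2)[of 0] by linarith+
  have "\<bar>(\<integral>x. f x \<partial>M) - (\<integral>x. g x \<partial>M)\<bar> = \<bar>\<integral>x. f x - g x \<partial>M\<bar>"
    using intf intg by simp
  also have "\<dots> \<le> (\<integral>x. \<bar>f x - g x\<bar> \<partial>M)"
    by (rule integral_abs_bound)
  also have "\<dots> \<le> (\<integral>x. e + (B + C) * indicator {x. norm x > K} x \<partial>M)"
  proof (rule integral_mono)
    show "\<bar>f x - g x\<bar> \<le> e + (B + C) * indicator {x. norm x > K} x" for x
      using close[of x] f(2)[of x] g(2)[of x] \<open>0 \<le> e\<close>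
      by (cases "norm x > K") (auto simp: abs_le_iff)
  qed (use intf intg S in \<open>auto intro!: integrable_real_indicator simp: emeasure_eq_measure\<close>)
  also have "\<dots> = e + (B + C) * measure M {x. norm x > K}"
    using S by (subst Bochner_Integration.integral_add)
      (auto intro!: integrable_real_indicator simp: emeasure_eq_measure prob_space[simplified])
  also have "\<dots> \<le> e + (B + C) * d"
    using tail BC by (intro add_left_mono mult_left_mono) auto
  finally show ?thesis .
qed

lemma prob_space_tight:
  fixes M :: "'a::euclidean_space measure"
  assumes "prob_space M" and sets: "sets M = sets borel" and "0 < e"
  shows "\<exists>K. measure M {x. norm x > K} \<le> e"
proof -
  interpret prob_space M by fact
  have "(\<lambda>n. measure M {x. norm x > real n}) \<longlonglongrightarrow> measure M (\<Inter>n. {x. norm x > real n})"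
    by (rule finite_Lim_measure_decseq) (auto simp: decseq_def sets)
  also have "(\<Inter>n. {x::'a. norm x > real n}) = {}"
  proof -
    have "\<exists>n. \<not> norm x > real n" for x :: 'a
      using reals_Archimedean2[of "norm x"] less_asym by blast
    then show ?thesis by blast
  qed
  finally have "(\<lambda>n. measure M {x. norm x > real n}) \<longlonglongrightarrow> 0" by simp
  from order_tendstoD(2)[OF this \<open>0 < e\<close>] obtain n where "measure M {x. norm x > real n} < e"
    by (auto simp: eventually_sequentially)
  then show ?thesis by (intro exI[of _ "real n"]) simp
qed

text \<open>The map \<open>S\<close> below is periodic and injective on a large ball, so a polynomial in \<open>S x\<close> can
  approximate the test function on that ball and stays bounded outside of it.\<close>

theorem weak_converges_char:
  fixes \<mu> :: "nat \<Rightarrow> 'a::euclidean_space measure"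
  assumes prob: "\<And>n. prob_space (\<mu> n)" and sets: "\<And>n. sets (\<mu> n) = sets borel"
    and prob_lim: "prob_space \<nu>" and sets_lim: "sets \<nu> = sets borel"
    and tight: "\<And>e. 0 < e \<Longrightarrow> \<exists>K. \<forall>n. measure (\<mu> n) {x. norm x > K} \<le> e"
    and char: "\<And>t. (\<lambda>n. \<integral>x. iexp (t \<bullet> x) \<partial>\<mu> n) \<longlonglongrightarrow> (\<integral>x. iexp (t \<bullet> x) \<partial>\<nu>)"
  shows "weak_converges \<mu> \<nu>"
  unfolding weak_converges_def
proof (intro allI impI)
  fix g :: "'a \<Rightarrow> real"
  assume cont: "continuous_on UNIV g" and "bounded (range g)"
  then obtain B where B: "\<And>x. \<bar>g x\<bar> \<le> B" "0 < B"
    by (auto simp: bounded_pos)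
  show "(\<lambda>n. \<integral>x. g x \<partial>\<mu> n) \<longlonglongrightarrow> (\<integral>x. g x \<partial>\<nu>)"
  proof (rule LIMSEQ_I)
    fix \<epsilon> :: real assume "0 < \<epsilon>"
    \<comment> \<open>The two-part error \<open>e + (B + (B + 1)) * e = (2 * B + 2) * e\<close> must
      stay below \<open>\<epsilon> / 3\<close>. The cap at 1 lets the approximant be bounded by
      \<open>B + 1\<close>.\<close>
    define e where "e = min 1 (\<epsilon> / (3 * (2 * B + 2)))"
    have e: "0 < e" "e \<le> 1"
      using \<open>0 < \<epsilon>\<close> B(2) by (auto simp: e_def)
    have "(2 * B + 2) * e \<le> (2 * B + 2) * (\<epsilon> / (3 * (2 * B + 2)))"
      using B(2) by (intro mult_left_mono) (auto simp: e_def)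
    also have "\<dots> = \<epsilon> / 3" using B(2) by (simp add: field_simps)
    finally have e_small: "(2 * B + 2) * e \<le> \<epsilon> / 3" .
    obtain K1 where K1: "\<And>n. measure (\<mu> n) {x. norm x > K1} \<le> e"
      using tight[OF e(1)] by blast
    obtain K2 where K2: "measure \<nu> {x. norm x > K2} \<le> e"
      using prob_space_tight[OF prob_lim sets_lim e(1)] by blast
    define K where "K = max 1 (max K1 K2)"
    have K: "K > 0" by (simp add: K_def)
    have tail: "measure M {x. norm x > K} \<le> e"
      if "measure M {x. norm x > K'} \<le> e" "K' \<le> K" "prob_space M" "sets M = sets borel"
      for M :: "'a measure" and K'
    proof -
      interpret prob_space M by fact
      have "measure M {x. norm x > K} \<le> measure M {x. norm x > K'}"
        using that by (intro finite_measure_mono) (auto simp: that(4))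
      then show ?thesis using that by linarith
    qed
    \<comment> \<open>This scale sends \<open>[-K, K]\<close> onto \<open>[-pi/2, pi/2]\<close>,
      where \<open>arcsin\<close> inverts \<open>sin\<close>; hence \<open>\<psi>\<close> is a left
      inverse of \<open>S\<close> on the ball of radius \<open>K\<close>.\<close>
    define c where "c = pi / (2 * K)"
    have c: "c > 0" using K by (simp add: c_def)
    define S where "S = (\<lambda>x::'a. \<Sum>b\<in>Basis. sin (c * (x \<bullet> b)) *\<^sub>R b)"
    define \<psi> where "\<psi> = (\<lambda>p::'a. \<Sum>b\<in>Basis. (arcsin (p \<bullet> b) / c) *\<^sub>R b)"
    have S_inner: "S x \<bullet> b = sin (c * (x \<bullet> b))" if "b \<in> Basis" for x b
      using that by (simp add: S_def)
    have S_in: "S x \<in> cbox (- One) One" for x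
      by (auto simp: mem_box S_inner)
    have \<psi>_S: "\<psi> (S x) = x" if "norm x \<le> K" for x
    proof -
      have "arcsin (S x \<bullet> b) / c = x \<bullet> b" if b: "b \<in> Basis" for b
      proof -
        have "\<bar>x \<bullet> b\<bar> \<le> K" using Basis_le_norm[OF b, of x] \<open>norm x \<le> K\<close> by linarith
        then have "\<bar>c * (x \<bullet> b)\<bar> \<le> c * K"
          using c by (simp add: abs_mult)
        also have "c * K = pi / 2" using K by (simp add: c_def)
        finally show ?thesis using c b by (simp add: S_inner arcsin_sin abs_le_iff)
      qed
      then have "\<psi> (S x) = (\<Sum>b\<in>Basis. (x \<bullet> b) *\<^sub>R b)" by (simp add: \<psi>_def)
      then show ?thesis by (simp add: euclidean_representation)
    qed
    have "continuous_on (cbox (- One) One) \<psi>"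
      unfolding \<psi>_def using c
      by (intro continuous_intros ballI) (auto simp: mem_box)
    then have "continuous_on (cbox (- One) One) (\<lambda>p. g (\<psi> p))"
      by (rule continuous_on_compose2[OF cont]) auto
    then obtain r where r: "real_polynomial_function r"
        "\<And>p. p \<in> cbox (- One) One \<Longrightarrow> \<bar>g (\<psi> p) - r p\<bar> < e"
      using Stone_Weierstrass_real_polynomial_function[OF compact_cbox _ e(1)] by metis
    define h where "h = (\<lambda>x. r (S x))"
    have trig: "trig_poly (\<lambda>x. complex_of_real (h x))"
      unfolding h_def S_def by (rule trig_poly_real_polynomial_sin[OF r(1)])
    have "continuous_on UNIV (\<lambda>x. Re (complex_of_real (h x)))"
      by (intro continuous_intros trig_poly_continuous[OF trig])
    then have h_cont: "continuous_on UNIV h" by simp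
    \<comment> \<open>Holds on the whole space, not only on the ball, because \<open>S\<close> takes
      all its values in the cube on which \<open>r\<close> approximates \<open>g\<close> composed
      with \<open>\<psi>\<close>.\<close>
    have h_bound: "\<bar>h x\<bar> \<le> B + 1" for x
      using r(2)[OF S_in, of x] B(1)[of "\<psi> (S x)"] e(2) by (simp add: h_def)
    have close: "\<bar>g x - h x\<bar> \<le> e" if "norm x \<le> K" for x
      using r(2)[OF S_in, of x] \<psi>_S[OF that] by (simp add: h_def)
    have approx: "\<bar>(\<integral>x. g x \<partial>M) - (\<integral>x. h x \<partial>M)\<bar> \<le> \<epsilon> / 3"
      if "measure M {x. norm x > K} \<le> e" "prob_space M" "sets M = sets borel" for M
    proof -
      have "\<bar>(\<integral>x. g x \<partial>M) - (\<integral>x. h x \<partial>M)\<bar> \<le> e + (B + (B + 1)) * e"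
        using that close B(1) h_bound e(1)
        by (intro integral_diff_le_of_tight[where K = K])
           (auto intro!: borel_measurable_continuous_onI cont h_cont)
      also have "\<dots> = (2 * B + 2) * e" by (simp add: algebra_simps)
      finally show ?thesis using e_small by linarith
    qed
    have "(\<lambda>n. \<integral>x. complex_of_real (h x) \<partial>\<mu> n) \<longlonglongrightarrow> (\<integral>x. complex_of_real (h x) \<partial>\<nu>)"
      by (rule trig_poly_integral_tendsto[OF prob sets prob_lim sets_lim char trig])
    then have "(\<lambda>n. \<integral>x. h x \<partial>\<mu> n) \<longlonglongrightarrow> (\<integral>x. h x \<partial>\<nu>)"
      by (simp add: tendsto_of_real_iff)
    then obtain N where N: "\<And>n. n \<ge> N \<Longrightarrow> norm ((\<integral>x. h x \<partial>\<mu> n) - (\<integral>x. h x \<partial>\<nu>)) < \<epsilon> / 3"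
      using LIMSEQ_D[of _ _ "\<epsilon> / 3"] \<open>0 < \<epsilon>\<close> by (metis divide_pos_pos zero_less_numeral)
    have "norm ((\<integral>x. g x \<partial>\<mu> n) - (\<integral>x. g x \<partial>\<nu>)) < \<epsilon>" if "n \<ge> N" for n
    proof -
      have "\<bar>(\<integral>x. g x \<partial>\<mu> n) - (\<integral>x. h x \<partial>\<mu> n)\<bar> \<le> \<epsilon> / 3"
        by (intro approx tail[OF K1] prob sets) (simp add: K_def)
      moreover have "\<bar>(\<integral>x. g x \<partial>\<nu>) - (\<integral>x. h x \<partial>\<nu>)\<bar> \<le> \<epsilon> / 3"
        by (intro approx tail[OF K2] prob_lim sets_lim) (simp add: K_def)
      ultimately show ?thesis using N[OF that] unfolding real_norm_def by linarith
    qed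
    then show "\<exists>N. \<forall>n\<ge>N. norm ((\<integral>x. g x \<partial>\<mu> n) - (\<integral>x. g x \<partial>\<nu>)) < \<epsilon>" by blast
  qed
qed

section \<open>Third-order expansion of zero-free moment generating functions\<close>

text \<open>The Moebius map \<open>w / (2 * A - w)\<close> carries the half plane
  \<open>Re w < A\<close> into the unit disc and fixes 0. The Schwarz lemma bounds its composition
  with the rescaled \<open>f\<close>, and the resulting inequality is solved for
  \<open>norm (f z)\<close>.\<close>

lemma Borel_Caratheodory:
  assumes hol: "f holomorphic_on ball 0 R" and "f 0 = 0"
    and Re_less: "\<And>z. norm z < R \<Longrightarrow> Re (f z) < A" and z: "norm z < R"
  shows "norm (f z) \<le> 2 * A * norm z / (R - norm z)"
proof -
  have R: "0 < R" using z norm_ge_zero[of z] by linarith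
  have A: "0 < A" using Re_less[of 0] R \<open>f 0 = 0\<close> by simp
  \<comment> \<open>A point with real part below \<open>A\<close> is closer to 0 than to
    \<open>2 * A\<close>: the squared distances differ by
    \<open>4 * A * (A - Re (f w))\<close>.\<close>
  have less: "norm (f w) < norm (2 * A - f w)" if "norm w < R" for w
  proof -
    have "0 < 4 * A * (A - Re (f w))" using Re_less[OF that] A by simp
    then have "(norm (f w))\<^sup>2 < (norm (2 * A - f w))\<^sup>2"
      unfolding cmod_power2 by (simp add: power2_eq_square algebra_simps)
    then show ?thesis by (simp add: power2_less_imp_less)
  qed
  define \<phi> where "\<phi> = (\<lambda>w::complex. f (R * w) / (2 * A - f (R * w)))"
  have scaled: "norm (complex_of_real R * w) < R" if "norm w < 1" for w :: complex
    using that R by (simp add: norm_mult)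
  have denom: "2 * complex_of_real A - f (R * w) \<noteq> 0" if "norm w < 1" for w :: complex
    using less[OF scaled[OF that]] norm_ge_zero[of "f (R * w)"] by fastforce
  have "(\<lambda>w::complex. f (R * w)) holomorphic_on ball 0 1"
    by (rule holomorphic_on_compose_gen[OF _ hol, unfolded o_def])
       (use scaled in \<open>auto intro!: holomorphic_intros\<close>)
  then have "\<phi> holomorphic_on ball 0 1"
    unfolding \<phi>_def using denom by (intro holomorphic_intros) auto
  moreover have "norm (\<phi> w) < 1" if "norm w < 1" for w :: complex
    using less[OF scaled[OF that]] by (auto simp: \<phi>_def norm_divide divide_less_eq)
  moreover have "norm (z / R) < 1" using z R by (simp add: norm_divide)
  ultimately have "norm (\<phi> (z / R)) \<le> norm (z / R)"
    by (intro Schwarz_Lemma(1)) (auto simp: \<phi>_def \<open>f 0 = 0\<close>)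
  then have "norm (f z) / norm (2 * A - f z) \<le> norm z / R"
    using R by (simp add: \<phi>_def norm_divide)
  then have "norm (f z) \<le> norm z / R * norm (2 * A - f z)"
    using less[OF z] by (subst (asm) pos_divide_le_eq) (auto intro: le_less_trans[OF norm_ge_zero])
  also have "\<dots> \<le> norm z / R * (2 * A + norm (f z))"
    using norm_triangle_ineq4[of "2 * complex_of_real A" "f z"] A R
    by (intro mult_left_mono) (auto simp: norm_mult)
  finally have "R * norm (f z) \<le> norm z * (2 * A + norm (f z))"
    using R by (simp add: field_simps)
  then have "norm (f z) * (R - norm z) \<le> 2 * A * norm z"
    by (simp add: algebra_simps)
  then show ?thesis using z by (simp add: pos_le_divide_eq)
qed

text \<open>A disc is contractible, so a logarithm exists; subtracting its value at 0 normalises it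
  and leaves the exponential unchanged because \<open>g 0 = 1\<close>.\<close>

lemma holomorphic_log_at_0:
  assumes hol: "g holomorphic_on ball 0 R" and nz: "\<And>z. norm z < R \<Longrightarrow> g z \<noteq> 0"
    and "g 0 = 1" "0 < R"
  obtains L where "L holomorphic_on ball 0 R" "\<And>z. norm z < R \<Longrightarrow> g z = exp (L z)" "L 0 = 0"
proof -
  obtain l where l: "l holomorphic_on ball 0 R" "\<And>z. z \<in> ball 0 R \<Longrightarrow> g z = exp (l z)"
    using contractible_imp_holomorphic_log[OF hol convex_imp_contractible[OF convex_ball]] nz
    by auto
  define L where "L = (\<lambda>z. l z - l 0)"
  have "exp (l 0) = 1" using l(2)[of 0] assms by simp
  then have "g z = exp (L z)" if "norm z < R" for z
    using l(2)[of z] that by (simp add: L_def exp_diff)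
  moreover have "L holomorphic_on ball 0 R"
    unfolding L_def by (intro holomorphic_intros l)
  ultimately show ?thesis using that by (simp add: L_def)
qed

text \<open>A one-sided bound on \<open>Re (log g)\<close> suffices: Borel-Caratheodory turns it
  into a bound on \<open>log g\<close>, and Cauchy's estimate into one on the third derivative. The
  remainder is therefore linear in \<open>A\<close>, the logarithm of the growth bound.\<close>

lemma exp_log_third_order:
  assumes hol: "g holomorphic_on ball 0 R" and nz: "\<And>z. norm z < R \<Longrightarrow> g z \<noteq> 0"
    and g0: "g 0 = 1" and growth: "\<And>z. norm z < R \<Longrightarrow> norm (g z) < exp A"
    and R: "0 < R" and z: "norm z \<le> R / 4"
  shows "\<exists>d. g z = exp (deriv g 0 * z + (deriv (deriv g) 0 - (deriv g 0)\<^sup>2) * z\<^sup>2 / 2 + d)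
           \<and> norm d \<le> 384 * A * norm z ^ 3 / R ^ 3"
proof -
  obtain L where L: "L holomorphic_on ball 0 R" "\<And>z. norm z < R \<Longrightarrow> g z = exp (L z)" "L 0 = 0"
    using holomorphic_log_at_0[OF hol nz g0 R] by blast
  have A: "0 < A" using growth[of 0] g0 R by simp
  have Re_L: "Re (L w) < A" if "norm w < R" for w
    using growth[OF that] L(2)[OF that] by simp
  have L_bound: "norm (L w) \<le> 2 * A" if "norm w \<le> R / 2" for w
  proof -
    have w: "norm w < R" using that R by linarith
    have "norm (L w) \<le> 2 * A * norm w / (R - norm w)"
      by (rule Borel_Caratheodory[OF L(1,3) Re_L w])
    also have "\<dots> \<le> 2 * A * (R / 2) / (R / 2)"
      using that R A by (intro frac_le mult_left_mono) auto
    finally show ?thesis using R by simp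
  qed
  define D where "D = (\<lambda>i. (deriv ^^ i) L)"
  have D_deriv: "(D i has_field_derivative D (Suc i) w) (at w)" if "norm w < R" for i w
    unfolding D_def using holomorphic_higher_deriv[OF L(1) open_ball, of i] that
    by (auto intro!: holomorphic_derivI[where S = "ball 0 R"])
  \<comment> \<open>Circles of radius \<open>R / 4\<close> about such \<open>w\<close> stay in the
    disc of radius \<open>R / 2\<close>, where \<open>L\<close> is at most \<open>2 * A\<close>; the
    constant is 3! * 2 * 4^3 = 768.\<close>
  have D3: "norm (D 3 w) \<le> 768 * A / R ^ 3" if "norm w \<le> R / 4" for w
  proof -
    have cb: "norm x \<le> R / 2" if "dist w x \<le> R / 4" for x
      using that \<open>norm w \<le> R / 4\<close> norm_triangle_ineq2[of x w] by (simp add: dist_norm norm_minus_commute)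
    have sub: "cball w (R / 4) \<subseteq> ball 0 R" using cb R by fastforce
    have "norm ((deriv ^^ 3) L w) \<le> fact 3 * (2 * A) / (R / 4) ^ 3"
    proof (rule Cauchy_inequality)
      show "L holomorphic_on ball w (R / 4)"
        using sub ball_subset_cball by (blast intro: holomorphic_on_subset[OF L(1)])
      show "continuous_on (cball w (R / 4)) L"
        by (rule continuous_on_subset[OF holomorphic_on_imp_continuous_on[OF L(1)] sub])
      show "norm (L x) \<le> 2 * A" if "norm (w - x) = R / 4" for x
        using that by (intro L_bound cb) (simp add: dist_norm)
    qed (use R in auto)
    then show ?thesis by (simp add: D_def fact_numeral power_divide)
  qed
  \<comment> \<open>The form of Taylor's bound used here divides by 2! rather than 3!, which turns
    768 into 384.\<close>
  have "norm (D 0 z - (\<Sum>i\<le>2. D i 0 * (z - 0) ^ i / fact i))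
      \<le> 768 * A / R ^ 3 * norm (z - 0) ^ Suc 2 / fact 2"
  proof (rule complex_Taylor[where S = "cball 0 (R / 4)"])
    show "(D i has_field_derivative D (Suc i) x) (at x within cball 0 (R / 4))"
      if "x \<in> cball 0 (R / 4)" for i x
    proof -
      have "norm x < R" using that R by (simp add: divide_simps)
      then show ?thesis by (rule has_field_derivative_at_within[OF D_deriv])
    qed
    show "norm (D (Suc 2) x) \<le> 768 * A / R ^ 3" if "x \<in> cball 0 (R / 4)" for x
      using D3[of x] that by (simp add: numeral_3_eq_3)
  qed (use z R in auto)
  moreover have "(\<Sum>i\<le>2. D i 0 * (z - 0) ^ i / fact i) = D 1 0 * z + D 2 0 * z\<^sup>2 / 2"
    using L(3) by (simp add: eval_nat_numeral D_def)
  ultimately have taylor: "norm (L z - (D 1 0 * z + D 2 0 * z\<^sup>2 / 2)) \<le> 384 * A * norm z ^ 3 / R ^ 3"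
    by (simp add: D_def eval_nat_numeral)
  have near: "\<forall>\<^sub>F x in nhds w. norm x < R" if "norm w < R" for w :: complex
    using eventually_nhds_in_open[OF open_ball, of w 0 R] that by simp
  \<comment> \<open>Writing g' = L' g and differentiating once more identifies L'(0) and L''(0) with
    the derivatives of \<open>g\<close>, without differentiating a quotient.\<close>
  have g_deriv: "(g has_field_derivative D 1 w * g w) (at w)" if w: "norm w < R" for w
  proof -
    have "((\<lambda>x. exp (L x)) has_field_derivative exp (L w) * D 1 w) (at w)"
      using D_deriv[OF w, of 0] by (auto intro!: derivative_eq_intros simp: D_def)
    moreover have "\<forall>\<^sub>F x in nhds w. g x = exp (L x)"
      using near[OF w] by eventually_elim (rule L(2))
    ultimately show ?thesis
      using L(2)[OF w] by (subst DERIV_cong_ev[OF refl _ refl]) (simp_all add: mult.commute)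
  qed
  have d1: "D 1 0 = deriv g 0"
    using DERIV_imp_deriv[OF g_deriv[of 0]] R g0 by simp
  have dg: "((\<lambda>x. D 1 x * g x) has_field_derivative D 2 0 * g 0 + D 1 0 * (D 1 0 * g 0)) (at 0)"
    using DERIV_mult[OF D_deriv[of 0 1] g_deriv[of 0]] R
    by (simp add: eval_nat_numeral algebra_simps)
  have "\<forall>\<^sub>F x in nhds 0. deriv g x = D 1 x * g x"
    using near[of 0] R by (auto elim!: eventually_mono intro!: DERIV_imp_deriv simp: g_deriv[simplified])
  then have "deriv (deriv g) 0 = D 2 0 * g 0 + D 1 0 * (D 1 0 * g 0)"
    using DERIV_imp_deriv[OF dg] by (simp only: deriv_cong_ev[OF _ refl])
  then have d2: "D 2 0 = deriv (deriv g) 0 - (deriv g 0)\<^sup>2"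
    using d1 g0 by (simp add: power2_eq_square)
  show ?thesis
    using taylor L(2)[of z] z R unfolding d1 d2
    by (intro exI[of _ "L z - (deriv g 0 * z + (deriv (deriv g) 0 - (deriv g 0)\<^sup>2) * z\<^sup>2 / 2)"]) auto
qed

text \<open>For a finite law with weights \<open>p\<close> and values \<open>w\<close>, the factor
  \<open>exp (- (z * m))\<close> cancels the linear term of the logarithm and leaves the variance.
  Only values of nonzero weight are bounded, since a product of ranges may contain pairs of
  probability zero.\<close>

lemma exp_sum_third_order:
  fixes p w :: "'i \<Rightarrow> real" and z :: complex and R K m :: real
  assumes "finite I" and p: "\<And>i. i \<in> I \<Longrightarrow> 0 \<le> p i" and sum_p: "(\<Sum>i\<in>I. p i) = 1"
    and w: "\<And>i. i \<in> I \<Longrightarrow> p i \<noteq> 0 \<Longrightarrow> \<bar>w i\<bar> \<le> K"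
    and nz: "\<And>u::complex. norm u < R \<Longrightarrow> (\<Sum>i\<in>I. p i * exp (u * w i)) \<noteq> 0"
    and R: "0 < R" and z: "norm z \<le> R / 4"
  defines "m \<equiv> (\<Sum>i\<in>I. p i * w i)"
  shows "\<exists>d. (\<Sum>i\<in>I. p i * exp (z * (w i - m)))
            = exp (of_real (\<Sum>i\<in>I. p i * (w i - m)\<^sup>2) * z\<^sup>2 / 2 + d)
           \<and> norm d \<le> 384 * (R * K + 1) * norm z ^ 3 / R ^ 3"
proof -
  define g where "g = (\<lambda>u::complex. \<Sum>i\<in>I. p i * exp (u * w i))"
  have g1: "(g has_field_derivative (\<Sum>i\<in>I. p i * w i * exp (u * w i))) (at u)" for u :: complex
    unfolding g_def by (auto intro!: derivative_eq_intros simp: algebra_simps)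
  then have dg: "deriv g = (\<lambda>u::complex. \<Sum>i\<in>I. p i * w i * exp (u * w i))"
    by (auto intro: DERIV_imp_deriv)
  have "(deriv g has_field_derivative of_real (\<Sum>i\<in>I. p i * (w i)\<^sup>2)) (at 0)"
    unfolding dg by (auto intro!: derivative_eq_intros simp: power2_eq_square algebra_simps)
  then have ddg: "deriv (deriv g) 0 = of_real (\<Sum>i\<in>I. p i * (w i)\<^sup>2)"
    by (rule DERIV_imp_deriv)
  \<comment> \<open>The summand 1 makes the growth bound strict, as
    \<open>exp_log_third_order\<close> demands.\<close>
  have "norm (g u) < exp (R * K + 1)" if u: "norm u < R" for u
  proof -
    have "norm (g u) \<le> (\<Sum>i\<in>I. p i * exp (R * K))"
      unfolding g_def
    proof (rule order_trans[OF norm_sum sum_mono])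
      fix i assume i: "i \<in> I"
      have "Re u * w i \<le> R * K" if "p i \<noteq> 0"
      proof -
        have "\<bar>Re u * w i\<bar> \<le> R * K"
          unfolding abs_mult using w[OF i that] abs_Re_le_cmod[of u] u R
          by (intro mult_mono) auto
        then show ?thesis by simp
      qed
      then show "norm (complex_of_real (p i) * exp (u * complex_of_real (w i))) \<le> p i * exp (R * K)"
        using p[OF i] by (cases "p i = 0") (auto simp: norm_mult)
    qed
    also have "\<dots> = exp (R * K)" by (simp add: sum_p flip: sum_distrib_right)
    finally show ?thesis by (rule le_less_trans) simp
  qed
  moreover have "g holomorphic_on ball 0 R"
    unfolding g_def by (intro holomorphic_intros)
  moreover have "g 0 = 1" using sum_p by (simp add: g_def flip: of_real_sum)
  ultimately obtain d where d: "norm d \<le> 384 * (R * K + 1) * norm z ^ 3 / R ^ 3"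
    "g z = exp (deriv g 0 * z + (deriv (deriv g) 0 - (deriv g 0)\<^sup>2) * z\<^sup>2 / 2 + d)"
    using exp_log_third_order[of g R "R * K + 1" z] nz R z unfolding g_def by blast
  have m: "deriv g 0 = of_real m" by (simp add: dg m_def)
  have "(\<Sum>i\<in>I. p i * (w i - m)\<^sup>2)
      = (\<Sum>i\<in>I. p i * (w i)\<^sup>2) - 2 * m * (\<Sum>i\<in>I. p i * w i) + m\<^sup>2 * (\<Sum>i\<in>I. p i)"
    by (simp add: power2_diff algebra_simps sum.distrib sum_subtractf sum_distrib_left sum_distrib_right)
  also have "\<dots> = (\<Sum>i\<in>I. p i * (w i)\<^sup>2) - m\<^sup>2"
    by (simp add: sum_p flip: m_def) (simp add: power2_eq_square)
  finally have var: "complex_of_real (\<Sum>i\<in>I. p i * (w i - m)\<^sup>2) = deriv (deriv g) 0 - (deriv g 0)\<^sup>2"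
    by (simp add: ddg m)
  have "(\<Sum>i\<in>I. p i * exp (z * (w i - m))) = exp (- (z * m)) * g z"
    by (simp add: g_def sum_distrib_left right_diff_distrib exp_diff exp_minus field_simps)
  also have "\<dots> = exp (of_real (\<Sum>i\<in>I. p i * (w i - m)\<^sup>2) * z\<^sup>2 / 2 + d)"
    unfolding d(2) var m by (simp flip: exp_add add: algebra_simps)
  finally show ?thesis using d(1) by blast
qed

section \<open>Probability generating polynomials\<close>

lemma coeff_prob_gen_poly:
  assumes "finite (U ` space P)" "finite (V ` space P)"
    and "r \<in> U ` space P" "q \<in> V ` space P"
  shows "coeff (coeff (prob_gen_poly P U V) r) q = measure P {\<omega> \<in> space P. U \<omega> = r \<and> V \<omega> = q}"
proof -
  let ?p = "\<lambda>r q. measure P {\<omega> \<in> space P. U \<omega> = r \<and> V \<omega> = q}"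
  have "coeff (coeff (prob_gen_poly P U V) r) q
      = (\<Sum>r'\<in>U ` space P. \<Sum>q'\<in>V ` space P. if q' = q then if r' = r then ?p r' q' else 0 else 0)"
    by (auto simp: prob_gen_poly_def coeff_sum coeff_monom intro!: sum.cong)
  then show ?thesis using assms by simp
qed

lemma degree_coeff_le_degree_y: "r \<le> degree f \<Longrightarrow> degree (coeff f r) \<le> degree_y f"
  unfolding degree_y_def by (intro Max_ge) auto

text \<open>A null value may lie in the range of \<open>U\<close> or \<open>V\<close> yet above the
  degree, so the degrees bound only pairs of positive probability. This is where \<open>M n\<close>
  enters as a bound on the exponents.\<close>

lemma prob_gen_poly_support:
  assumes fin: "finite (U ` space P)" "finite (V ` space P)"
    and rq: "r \<in> U ` space P" "q \<in> V ` space P"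
    and "measure P {\<omega> \<in> space P. U \<omega> = r \<and> V \<omega> = q} \<noteq> 0"
  shows "r \<le> degree (prob_gen_poly P U V)" "q \<le> degree_y (prob_gen_poly P U V)"
proof -
  let ?f = "prob_gen_poly P U V"
  have nz: "coeff (coeff ?f r) q \<noteq> 0"
    using assms by (simp add: coeff_prob_gen_poly)
  then show r: "r \<le> degree ?f" by (intro le_degree) auto
  from nz have "q \<le> degree (coeff ?f r)" by (rule le_degree)
  then show "q \<le> degree_y ?f" using degree_coeff_le_degree_y[OF r] by linarith
qed

section \<open>Evaluation at complex points\<close>

lemma ceval2_add: "ceval2 (f + g) x y = ceval2 f x y + ceval2 g x y"
proof -
  have map_add: "map_poly h (p + q) = map_poly h p + map_poly h q"
    if "h 0 = 0" "\<And>a b. h (a + b) = h a + h b"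
    for h :: "'b::comm_monoid_add \<Rightarrow> 'c::comm_monoid_add" and p q
    using that by (intro poly_eqI) (simp add: coeff_map_poly)
  show ?thesis unfolding ceval2_def
    by (subst map_add) (simp_all add: map_add)
qed

lemma ceval2_0 [simp]: "ceval2 0 x y = 0"
  by (simp add: ceval2_def)

lemma ceval2_sum: "ceval2 (\<Sum>i\<in>I. f i) x y = (\<Sum>i\<in>I. ceval2 (f i) x y)"
  by (induction I rule: infinite_finite_induct) (simp_all add: ceval2_add)

lemma ceval2_monom: "ceval2 (monom (monom c q) r) x y = of_real c * x ^ r * y ^ q"
  by (simp add: ceval2_def map_poly_monom poly_monom)

lemma ceval2_prob_gen_poly:
  "ceval2 (prob_gen_poly P U V) x y =
    (\<Sum>r\<in>U ` space P. \<Sum>q\<in>V ` space P.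
       of_real (measure P {\<omega> \<in> space P. U \<omega> = r \<and> V \<omega> = q}) * x ^ r * y ^ q)"
  by (simp add: prob_gen_poly_def ceval2_sum ceval2_monom)

text \<open>Decomposes the function over the finitely many level events of the pair, so that
  expectations become the finite sums on which the complex analysis works.\<close>

lemma (in prob_space) finite_pair_expectation:
  fixes h :: "nat \<Rightarrow> nat \<Rightarrow> 'b::{banach, second_countable_topology}"
  assumes U: "U \<in> measurable M (count_space UNIV)" and V: "V \<in> measurable M (count_space UNIV)"
    and fin: "finite (U ` space M)" "finite (V ` space M)"
  shows integrable_finite_pair: "integrable M (\<lambda>\<omega>. h (U \<omega>) (V \<omega>))" (is "integrable M ?f")
    and expectation_finite_pair: "(\<integral>\<omega>. h (U \<omega>) (V \<omega>) \<partial>M) = (\<Sum>(r, q)\<in>U ` space M \<times> V ` space M.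
           prob {\<omega> \<in> space M. U \<omega> = r \<and> V \<omega> = q} *\<^sub>R h r q)"
proof -
  let ?I = "U ` space M \<times> V ` space M"
  define E where "E = (\<lambda>(r, q). {\<omega> \<in> space M. U \<omega> = r \<and> V \<omega> = q})"
  have E: "E i \<in> events" for i
    unfolding E_def using U V by (auto split: prod.split)
  define g where "g = (\<lambda>\<omega>. \<Sum>i\<in>?I. indicator (E i) \<omega> *\<^sub>R case_prod h i)"
  have f: "?f \<omega> = g \<omega>" if \<omega>: "\<omega> \<in> space M" for \<omega>
  proof -
    have "indicator (E i) \<omega> *\<^sub>R case_prod h i = (if i = (U \<omega>, V \<omega>) then h (U \<omega>) (V \<omega>) else 0)" for i
      using \<omega> by (auto simp: E_def indicator_def split: prod.split)
    then show ?thesis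
      unfolding g_def using \<omega> fin by (simp only:) (simp add: sum.delta)
  qed
  have int: "integrable M (\<lambda>\<omega>. indicator (E i) \<omega> *\<^sub>R case_prod h i)" for i
    using E by (intro integrable_scaleR_left integrable_real_indicator) (auto simp: emeasure_eq_measure)
  then have "integrable M g"
    unfolding g_def by (intro Bochner_Integration.integrable_sum)
  then show "integrable M ?f"
    by (simp cong: Bochner_Integration.integrable_cong add: f)
  have "(\<integral>\<omega>. ?f \<omega> \<partial>M) = (\<integral>\<omega>. g \<omega> \<partial>M)"
    by (rule Bochner_Integration.integral_cong[OF refl f])
  also have "\<dots> = (\<Sum>i\<in>?I. \<integral>\<omega>. indicator (E i) \<omega> *\<^sub>R case_prod h i \<partial>M)"
    unfolding g_def by (rule Bochner_Integration.integral_sum[OF int])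
  also have "\<dots> = (\<Sum>i\<in>?I. prob (E i) *\<^sub>R case_prod h i)"
    using E by (intro sum.cong) (auto simp: emeasure_eq_measure)
  finally show "(\<integral>\<omega>. ?f \<omega> \<partial>M) = (\<Sum>(r, q)\<in>?I. prob {\<omega> \<in> space M. U \<omega> = r \<and> V \<omega> = q} *\<^sub>R h r q)"
    by (simp add: E_def case_prod_unfold)
qed

text \<open>For \<open>0 < Im u < \<pi> / max a b\<close> both \<open>e\<^sup>u\<^sup>a\<close> and \<open>e\<^sup>u\<^sup>b\<close> lie in the upper half plane.\<close>

lemma real_stable2_ceval2_exp_nonzero:
  assumes stable: "real_stable2 f" and u: "0 < Im u" "Im u * a < pi" "Im u * b < pi"
    and ab: "0 < a" "0 < b"
  shows "ceval2 f (exp (u * of_real a)) (exp (u * of_real b)) \<noteq> 0"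
proof -
  have "Im (exp (u * of_real c)) > 0" if "0 < c" "Im u * c < pi" for c
    using that u(1) by (simp add: Im_exp sin_gt_zero)
  with stable u ab show ?thesis by (simp add: real_stable2_def)
qed

text \<open>Stability covers the upper half of the strip, and conjugation the lower half because the
  coefficients are real. On the real axis, where stability is silent, the sum is the expectation of
  a positive function.\<close>

lemma prob_gen_poly_mgf_nonzero:
  fixes a b :: real and u :: complex
  assumes "prob_space P"
    and U: "U \<in> measurable P (count_space UNIV)" and V: "V \<in> measurable P (count_space UNIV)"
    and fin: "finite (U ` space P)" "finite (V ` space P)"
    and stable: "real_stable2 (prob_gen_poly P U V)"
    and ab: "0 < a" "0 < b" and u: "\<bar>Im u\<bar> * a < pi" "\<bar>Im u\<bar> * b < pi"
  shows "(\<Sum>(r, q)\<in>U ` space P \<times> V ` space P. complex_of_real (measure P {\<omega> \<in> space P. U \<omega> = r \<and> V \<omega> = q})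
           * exp (u * of_real (a * real r + b * real q))) \<noteq> 0"
proof -
  interpret prob_space P by fact
  define F where "F u = (\<Sum>(r, q)\<in>U ` space P \<times> V ` space P.
      complex_of_real (prob {\<omega> \<in> space P. U \<omega> = r \<and> V \<omega> = q})
      * exp (u * of_real (a * real r + b * real q)))" for u
  have F: "F v = ceval2 (prob_gen_poly P U V) (exp (v * of_real a)) (exp (v * of_real b))" for v
    unfolding ceval2_prob_gen_poly F_def
    by (auto simp: sum.cartesian_product case_prod_unfold exp_of_nat_mult[symmetric] exp_add[symmetric]
        algebra_simps intro!: sum.cong)
  have upper: "F v \<noteq> 0" if "0 < Im v" "Im v * a < pi" "Im v * b < pi" for v
    unfolding F by (rule real_stable2_ceval2_exp_nonzero[OF stable that ab])
  consider "0 < Im u" | "Im u < 0" | "Im u = 0" by linarith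
  then show ?thesis unfolding F_def[symmetric]
  proof cases
    case 1
    then show "F u \<noteq> 0" using u by (intro upper) auto
  next
    case 2
    have "F (cnj u) = cnj (F u)"
      by (simp add: F_def case_prod_unfold exp_cnj)
    moreover have "F (cnj u) \<noteq> 0" using 2 u by (intro upper) auto
    ultimately show "F u \<noteq> 0" by auto
  next
    case 3
    then have "u = of_real (Re u)" by (simp add: complex_eq_iff)
    then have "F u = (\<integral>\<omega>. complex_of_real (exp (Re u * (a * real (U \<omega>) + b * real (V \<omega>)))) \<partial>P)"
      by (subst expectation_finite_pair[OF U V fin, of "\<lambda>r q. complex_of_real (exp (Re u * (a * real r + b * real q)))"])
         (simp add: F_def case_prod_unfold scaleR_conv_of_real exp_of_real[symmetric])
    also have "\<dots> = complex_of_real (\<integral>\<omega>. exp (Re u * (a * real (U \<omega>) + b * real (V \<omega>))) \<partial>P)"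
      by simp
    also have "\<dots> \<noteq> 0"
    proof -
      let ?W = "\<lambda>\<omega>. exp (Re u * (a * real (U \<omega>) + b * real (V \<omega>)))"
      have "integrable P ?W"
        by (rule integrable_finite_pair[OF U V fin, of "\<lambda>r q. exp (Re u * (a * real r + b * real q))"])
      then have "0 < (\<integral>\<omega>. ?W \<omega> \<partial>P)"
        by (rule expectation_greater) auto
      then show ?thesis by simp
    qed
    finally show "F u \<noteq> 0" .
  qed
qed

text \<open>The error is linear in the degree and cubic in \<open>z\<close>, which is what makes
  \<open>M n\<close> of smaller order than the cube of \<open>s n\<close> the right scale.\<close>

lemma (in prob_space) stable_pair_mgf:
  fixes U V :: "'a \<Rightarrow> nat" and a b :: real and z :: complex and N :: nat
  assumes U: "U \<in> measurable M (count_space UNIV)" and V: "V \<in> measurable M (count_space UNIV)"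
    and fin: "finite (U ` space M)" "finite (V ` space M)"
    and stable: "real_stable2 (prob_gen_poly M U V)"
    and deg: "degree (prob_gen_poly M U V) \<le> N" "degree_y (prob_gen_poly M U V) \<le> N"
    and ab: "0 < a" "0 < b" and z: "4 * (a + b) * norm z \<le> 1"
  defines "W \<equiv> \<lambda>\<omega>. a * (real (U \<omega>) - (\<integral>\<omega>'. real (U \<omega>') \<partial>M)) + b * (real (V \<omega>) - (\<integral>\<omega>'. real (V \<omega>') \<partial>M))"
  shows "\<exists>d. (\<integral>\<omega>. exp (z * of_real (W \<omega>)) \<partial>M) = exp (of_real (\<integral>\<omega>. (W \<omega>)\<^sup>2 \<partial>M) * z\<^sup>2 / 2 + d)
           \<and> norm d \<le> 384 * (real N + 1) * ((a + b) * norm z) ^ 3"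
proof -
  define p where "p = (\<lambda>(r, q). prob {\<omega> \<in> space M. U \<omega> = r \<and> V \<omega> = q})"
  define I where "I = U ` space M \<times> V ` space M"
  define w where "w = (\<lambda>(r, q). a * real r + b * real q)"
  \<comment> \<open>With this radius \<open>\<bar>Im u\<bar> * a\<close> and
    \<open>\<bar>Im u\<bar> * b\<close> are at most 1, hence below \<open>pi\<close>. The exponents
    are bounded by \<open>(a + b) * N\<close>, so the growth exponent is
    \<open>R * ((a + b) * N) + 1 = N + 1\<close>.\<close>
  define R where "R = 1 / (a + b)"
  have R: "0 < R" using ab by (simp add: R_def)
  have expect: "(\<integral>\<omega>. h (U \<omega>) (V \<omega>) \<partial>M) = (\<Sum>i\<in>I. p i *\<^sub>R case_prod h i)"
    for h :: "nat \<Rightarrow> nat \<Rightarrow> 'b::{banach, second_countable_topology}"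
    by (simp add: expectation_finite_pair[OF U V fin] I_def p_def case_prod_unfold)
  define m where "m = (\<Sum>i\<in>I. p i * w i)"
  have "m = a * (\<integral>\<omega>'. real (U \<omega>') \<partial>M) + b * (\<integral>\<omega>'. real (V \<omega>') \<partial>M)"
    using expect[of "\<lambda>r q. real r"] expect[of "\<lambda>r q. real q"]
    by (simp add: m_def w_def case_prod_unfold sum_distrib_left algebra_simps flip: sum.distrib)
  then have W: "W \<omega> = (\<lambda>r q. w (r, q) - m) (U \<omega>) (V \<omega>)" for \<omega>
    by (simp add: W_def w_def algebra_simps)
  have K: "\<bar>w i\<bar> \<le> (a + b) * real N" if "i \<in> I" "p i \<noteq> 0" for i
  proof -
    obtain r q where i: "i = (r, q)" by (cases i)
    have "real r \<le> N" "real q \<le> N"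
      using prob_gen_poly_support[OF fin, of r q] that deg by (auto simp: i I_def p_def)
    then have "a * real r + b * real q \<le> a * real N + b * real N"
      using ab by (intro add_mono mult_left_mono) auto
    then show ?thesis using ab by (simp add: i w_def algebra_simps)
  qed
  have nz: "(\<Sum>i\<in>I. p i * exp (u * w i)) \<noteq> 0" if "norm u < R" for u :: complex
  proof -
    have "\<bar>Im u\<bar> * c < pi" if "c \<in> {a, b}" for c
    proof -
      have "\<bar>Im u\<bar> * c \<le> R * (a + b)"
        using abs_Im_le_cmod[of u] \<open>norm u < R\<close> that ab R by (intro mult_mono) auto
      also have "R * (a + b) = 1" using ab by (simp add: R_def)
      finally show ?thesis using pi_gt3 by linarith
    qed
    then show ?thesis
      using prob_gen_poly_mgf_nonzero[OF prob_space_axioms U V fin stable ab, of u]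
      by (simp add: I_def p_def w_def case_prod_unfold)
  qed
  have "(\<Sum>i\<in>I. p i) = 1"
    using expect[of "\<lambda>_ _. 1::real"] by (simp add: case_prod_unfold prob_space)
  then obtain d where d: "(\<Sum>i\<in>I. p i * exp (z * (w i - m)))
      = exp (of_real (\<Sum>i\<in>I. p i * (w i - m)\<^sup>2) * z\<^sup>2 / 2 + d)"
    "norm d \<le> 384 * (R * ((a + b) * real N) + 1) * norm z ^ 3 / R ^ 3"
    using exp_sum_third_order[of I p w "(a + b) * real N" R z] K nz R z fin ab
    by (auto simp: I_def m_def p_def R_def field_simps)
  have "(\<integral>\<omega>. exp (z * of_real (W \<omega>)) \<partial>M) = (\<Sum>i\<in>I. p i * exp (z * (w i - m)))"
    unfolding W expect[of "\<lambda>r q. exp (z * of_real (w (r, q) - m))"] by (simp add: scaleR_conv_of_real case_prod_unfold)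
  moreover have "(\<integral>\<omega>. (W \<omega>)\<^sup>2 \<partial>M) = (\<Sum>i\<in>I. p i * (w i - m)\<^sup>2)"
    unfolding W expect[of "\<lambda>r q. (w (r, q) - m)\<^sup>2"] by (simp add: case_prod_unfold)
  moreover have "norm d \<le> 384 * (real N + 1) * ((a + b) * norm z) ^ 3"
    using d(2) ab by (simp add: R_def power_divide power_mult_distrib mult_ac)
  ultimately show ?thesis using d(1) by auto
qed

section \<open>Analytic continuation from the positive quadrant\<close>

text \<open>Translating both arguments by a common real amount moves \<open>(t\<^sub>1, t\<^sub>2)\<close> into the
  positive quadrant; Montel's theorem and the identity theorem in the translation parameter
  bring the limit back.\<close>

lemma char_tendsto_of_positive_quadrant:
  fixes I :: "nat \<Rightarrow> 'i set" and p u v :: "nat \<Rightarrow> 'i \<Rightarrow> real" and \<alpha> \<beta> \<gamma> t1 t2 :: real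
  defines "F \<equiv> \<lambda>n z w. \<Sum>i\<in>I n. complex_of_real (p n i) * exp (z * of_real (u n i) + w * of_real (v n i))"
  defines "Q \<equiv> \<lambda>z w. of_real \<alpha> * z\<^sup>2 - 2 * of_real \<beta> * z * w + of_real \<gamma> * w\<^sup>2 :: complex"
  assumes p: "\<And>n i. i \<in> I n \<Longrightarrow> 0 \<le> p n i"
    and lim: "\<And>a b z. 0 < a \<Longrightarrow> 0 < b \<Longrightarrow>
      (\<lambda>n. F n (z * of_real a) (z * of_real b)) \<longlonglongrightarrow> exp (Q (z * of_real a) (z * of_real b) / 2)"
  shows "(\<lambda>n. F n (\<i> * of_real t1) (\<i> * of_real t2)) \<longlonglongrightarrow> exp (Q (\<i> * of_real t1) (\<i> * of_real t2) / 2)"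
proof -
  define h where "h = (\<lambda>n w. F n (\<i> * (of_real t1 + w)) (\<i> * (of_real t2 + w)))"
  define G where "G = (\<lambda>w. exp (Q (\<i> * (of_real t1 + w)) (\<i> * (of_real t2 + w)) / 2))"
  \<comment> \<open>For real \<open>x > m\<close> both \<open>t1 + x\<close> and
    \<open>t2 + x\<close> are positive, so \<open>lim\<close> applies with \<open>z\<close> equal to
    the imaginary unit.\<close>
  define m where "m = max (- t1) (- t2)"
  have h_hol: "h n holomorphic_on UNIV" for n
    unfolding h_def F_def by (intro holomorphic_intros)
  have G_hol: "G holomorphic_on UNIV"
    unfolding G_def Q_def by (intro holomorphic_intros) auto
  have lim_real: "(\<lambda>n. h n (of_real x)) \<longlonglongrightarrow> G (of_real x)" if "x > m" for x
    using lim[of "t1 + x" "t2 + x" \<i>] that by (simp add: h_def G_def m_def)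
  \<comment> \<open>The modulus of each exponential depends only on \<open>Im w\<close>. It is
    dominated by the sum of the real exponentials at \<open>\<rho>\<close> and
    \<open>- \<rho>\<close> in direction (1, 1), whose expectations converge by \<open>lim\<close>
    and so are bounded.\<close>
  have h_bound: "\<exists>B. \<forall>n w. \<bar>Im w\<bar> \<le> \<rho> \<longrightarrow> norm (h n w) \<le> B" for \<rho>
  proof -
    have "Bseq (\<lambda>n. F n (of_real c) (of_real c))" for c
      using convergent_imp_Bseq[OF convergentI[OF lim[of 1 1 "of_real c"]]] by simp
    then obtain B where B: "\<And>c n. norm (F n (of_real c) (of_real c)) \<le> B c"
      unfolding Bseq_def by metis
    have F_real: "norm (F n (of_real c) (of_real c)) = (\<Sum>i\<in>I n. p n i * exp (c * (u n i + v n i)))" for n c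
    proof -
      have "F n (of_real c) (of_real c) = of_real (\<Sum>i\<in>I n. p n i * exp (c * (u n i + v n i)))"
        by (simp add: F_def exp_of_real[symmetric] distrib_left)
      moreover have "0 \<le> (\<Sum>i\<in>I n. p n i * exp (c * (u n i + v n i)))"
        using p by (intro sum_nonneg mult_nonneg_nonneg) auto
      ultimately show ?thesis by (simp only: norm_of_real abs_of_nonneg)
    qed
    have "norm (h n w) \<le> B \<rho> + B (- \<rho>)" if w: "\<bar>Im w\<bar> \<le> \<rho>" for n w
    proof -
      have "norm (h n w) \<le> (\<Sum>i\<in>I n. p n i * exp (- Im w * (u n i + v n i)))"
        unfolding h_def F_def
        by (rule order_trans[OF norm_sum sum_mono]) (simp add: norm_mult p algebra_simps)
      also have "\<dots> \<le> (\<Sum>i\<in>I n. p n i * exp (\<rho> * (u n i + v n i)) + p n i * exp (- \<rho> * (u n i + v n i)))"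
      proof (rule sum_mono)
        fix i assume i: "i \<in> I n"
        let ?x = "u n i + v n i"
        have "\<bar>- Im w * ?x\<bar> \<le> \<rho> * \<bar>?x\<bar>"
          using w by (simp add: abs_mult mult_right_mono)
        then have "- Im w * ?x \<le> \<rho> * \<bar>?x\<bar>"
          by linarith
        moreover have "\<rho> * \<bar>?x\<bar> = \<rho> * ?x \<or> \<rho> * \<bar>?x\<bar> = - \<rho> * ?x"
          by (auto simp: abs_if algebra_simps)
        ultimately have "- Im w * ?x \<le> \<rho> * ?x \<or> - Im w * ?x \<le> - \<rho> * ?x"
          by metis
        then have "exp (- Im w * ?x) \<le> exp (\<rho> * ?x) \<or> exp (- Im w * ?x) \<le> exp (- \<rho> * ?x)"
          unfolding exp_le_cancel_iff .
        then have "exp (- Im w * ?x) \<le> exp (\<rho> * ?x) + exp (- \<rho> * ?x)"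
          using exp_ge_zero[of "\<rho> * ?x"] exp_ge_zero[of "- \<rho> * ?x"] by linarith
        from mult_left_mono[OF this p[OF i]]
        show "p n i * exp (- Im w * ?x) \<le> p n i * exp (\<rho> * ?x) + p n i * exp (- \<rho> * ?x)"
          by (simp only: distrib_left)
      qed
      also have "\<dots> = norm (F n (of_real \<rho>) (of_real \<rho>)) + norm (F n (of_real (- \<rho>)) (of_real (- \<rho>)))"
        by (simp only: F_real sum.distrib)
      also have "\<dots> \<le> B \<rho> + B (- \<rho>)" by (intro add_mono B)
      finally show ?thesis .
    qed
    then show ?thesis by blast
  qed
  have "(\<lambda>n. h n 0) \<longlonglongrightarrow> G 0"
  proof (rule ccontr)
    \<comment> \<open>Pass to a subsequence staying \<open>e\<close> away from \<open>G 0\<close>;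
      Montel extracts a locally uniform limit of it, and the identity theorem forces that limit to
      be \<open>G\<close>.\<close>
    assume "\<not> (\<lambda>n. h n 0) \<longlonglongrightarrow> G 0"
    then obtain e where e: "0 < e" "\<not> (\<forall>\<^sub>F n in sequentially. dist (h n 0) (G 0) < e)"
      by (auto simp: tendsto_iff)
    then have "infinite {n. dist (h n 0) (G 0) \<ge> e}"
      by (simp add: frequently_cofinite[symmetric] cofinite_eq_sequentially frequently_def not_le)
    from infinite_enumerate[OF this] obtain k :: "nat \<Rightarrow> nat"
      where k: "strict_mono k" "\<And>n. dist (h (k n) 0) (G 0) \<ge> e"
      by (auto simp only: mem_Collect_eq)
    have "\<exists>B. \<forall>f\<in>range h. \<forall>w\<in>K. norm (f w) \<le> B" if "compact K" for K
    proof -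
      obtain \<rho> where \<rho>: "\<And>w. w \<in> K \<Longrightarrow> norm w \<le> \<rho>"
        using compact_imp_bounded[OF \<open>compact K\<close>] by (auto simp: bounded_iff)
      have "\<bar>Im w\<bar> \<le> \<rho>" if "w \<in> K" for w
        using abs_Im_le_cmod[of w] \<rho>[OF that] by linarith
      with h_bound[of \<rho>] show ?thesis by blast
    qed
    then obtain g r where g: "g holomorphic_on UNIV" "strict_mono (r :: nat \<Rightarrow> nat)"
        "\<And>w. (\<lambda>n. (h \<circ> k) (r n) w) \<longlonglongrightarrow> g w"
      by (rule_tac Montel[of UNIV "range h" "h \<circ> k"]) (auto simp: h_hol)
    have g_eq: "g (of_real x) = G (of_real x)" if "x > m" for x
    proof (rule LIMSEQ_unique[OF g(3)])
      have "strict_mono (k \<circ> r)" using k(1) g(2) by (rule strict_mono_o)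
      from LIMSEQ_subseq_LIMSEQ[OF lim_real[OF that] this]
      show "(\<lambda>n. (h \<circ> k) (r n) (of_real x)) \<longlonglongrightarrow> G (of_real x)" by (simp add: o_def)
    qed
    have "g 0 - G 0 = 0"
    proof (rule analytic_continuation[of "\<lambda>w. g w - G w" UNIV "of_real ` {m<..}" "of_real (m + 1)"])
      show "complex_of_real (m + 1) islimpt of_real ` {m<..}"
        unfolding islimpt_approachable
      proof (intro allI impI)
        fix e :: real assume "0 < e"
        then show "\<exists>x'\<in>complex_of_real ` {m<..}. x' \<noteq> of_real (m + 1) \<and> dist x' (of_real (m + 1)) < e"
          by (intro bexI[of _ "of_real (m + 1 + e / 2)"] imageI)
             (simp_all only: dist_of_real of_real_eq_iff, auto simp: dist_real_def)
      qed
    qed (use g_eq in \<open>auto intro!: holomorphic_intros g G_hol\<close>)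
    then have "(\<lambda>n. h (k (r n)) 0) \<longlonglongrightarrow> G 0" using g(3)[of 0] by simp
    from tendstoD[OF this \<open>0 < e\<close>] obtain n where "dist (h (k (r n)) 0) (G 0) < e"
      by (auto simp: eventually_sequentially)
    with k(2)[of "r n"] show False by simp
  qed
  then show ?thesis by (simp add: h_def G_def)
qed

section \<open>Gaussian laws and the central limit theorem\<close>

lemma psd_2x2_det_nonneg:
  fixes \<alpha> \<beta> \<gamma> :: real
  assumes "\<And>a b. 0 \<le> \<alpha> * a\<^sup>2 - 2 * \<beta> * a * b + \<gamma> * b\<^sup>2"
  shows "0 \<le> \<alpha>" "0 \<le> \<gamma>" "\<beta>\<^sup>2 \<le> \<alpha> * \<gamma>"
proof -
  show \<alpha>: "0 \<le> \<alpha>" and \<gamma>: "0 \<le> \<gamma>" using assms[of 1 0] assms[of 0 1] by auto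
  show "\<beta>\<^sup>2 \<le> \<alpha> * \<gamma>"
  proof (cases "\<gamma> = 0")
    case True
    have "\<beta> = 0"
      \<comment> \<open>If \<open>\<gamma> = 0\<close> and \<open>\<beta>\<close> is nonzero, the
        form is affine in \<open>b\<close> at \<open>a = 1\<close>; this \<open>b\<close> gives it
        the value -1.\<close>
      using assms[of 1 "(\<alpha> + 1) / (2 * \<beta>)"] True by (cases "\<beta> = 0") auto
    then show ?thesis using \<alpha> \<gamma> by simp
  next
    case False
    \<comment> \<open>Evaluating the form at \<open>(\<gamma>, \<beta>)\<close> yields
      \<open>\<gamma>\<close> times the determinant.\<close>
    have "0 \<le> \<gamma> * (\<alpha> * \<gamma> - \<beta>\<^sup>2)"
      using assms[of \<gamma> \<beta>] by (simp add: power2_eq_square algebra_simps)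
    then show ?thesis using False \<gamma> by (simp add: zero_le_mult_iff)
  qed
qed

text \<open>For \<open>\<alpha> = 0\<close>, hence \<open>\<beta> = 0\<close>, the Cholesky factor below relies on \<open>x / 0 = 0\<close>.\<close>

lemma psd_2x2_factor:
  fixes \<alpha> \<beta> \<gamma> :: real
  assumes \<alpha>: "0 \<le> \<alpha>" and \<gamma>: "0 \<le> \<gamma>" and det: "\<beta>\<^sup>2 \<le> \<alpha> * \<gamma>"
  shows "\<exists>B :: real ^ 2 ^ 2. B ** transpose B = vector [vector [\<alpha>, \<beta>], vector [\<beta>, \<gamma>]]"
proof -
  define c where "c = \<beta> / sqrt \<alpha>"
  have c1: "sqrt \<alpha> * c = \<beta>"
    using \<alpha> det by (cases "\<alpha> = 0") (auto simp: c_def)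
  have "c\<^sup>2 \<le> \<gamma>"
    using \<alpha> \<gamma> det by (cases "\<alpha> = 0") (auto simp: c_def power_divide divide_le_eq mult.commute)
  then have c2: "c * c + sqrt (\<gamma> - c\<^sup>2) * sqrt (\<gamma> - c\<^sup>2) = \<gamma>"
    by (simp add: power2_eq_square)
  let ?B = "vector [vector [sqrt \<alpha>, 0], vector [c, sqrt (\<gamma> - c\<^sup>2)]] :: real ^ 2 ^ 2"
  have "?B ** transpose ?B = vector [vector [\<alpha>, \<beta>], vector [\<beta>, \<gamma>]]"
    using \<alpha> c1 c2
    by (simp add: vec_eq_iff forall_2 matrix_matrix_mult_def transpose_def sum_2 mult.commute)
  then show ?thesis by blast
qed

section \<open>Gaussian measures and second-moment tail bounds\<close>

lemma prob_space_std_gaussian: "prob_space std_gaussian"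
proof -
  interpret product_prob_space "\<lambda>_. std_normal_distribution" "UNIV :: 'n::finite set"
    by (intro product_prob_spaceI) (simp add: prob_space_normal_density)
  show ?thesis unfolding std_gaussian_def by (rule prob_space_distr[OF measurable_vec_lambda])
qed

lemma prob_space_centered_gaussian: "prob_space (centered_gaussian A)"
  unfolding centered_gaussian_def
  using measurable_matrix_vector_mult
  by (intro prob_space.prob_space_distr[OF prob_space_std_gaussian]) (simp add: std_gaussian_def)

lemma sets_centered_gaussian: "sets (centered_gaussian A) = sets borel"
  by (simp add: centered_gaussian_def)

lemma borel_measurable_vector_2:
  assumes "f \<in> borel_measurable M" "g \<in> borel_measurable M"
  shows "(\<lambda>x. vector [f x, g x] :: real ^ 2) \<in> borel_measurable M"
proof -
  have "(\<lambda>x. vector [f x, g x] :: real ^ 2) = (\<lambda>x. f x *\<^sub>R axis 1 1 + g x *\<^sub>R axis 2 1)"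
    by (simp add: fun_eq_iff vec_eq_iff forall_2 axis_def)
  then show ?thesis using assms by simp
qed

text \<open>Markov's inequality for the squared norm; with \<open>c = C / e\<close> a uniform
  second-moment bound \<open>C\<close> gives tightness.\<close>

lemma prob_norm_gt_le:
  fixes Z :: "'a \<Rightarrow> 'b::euclidean_space"
  assumes "prob_space M" and Z: "Z \<in> borel_measurable M"
    and int: "integrable M (\<lambda>\<omega>. (norm (Z \<omega>))\<^sup>2)" and le: "(\<integral>\<omega>. (norm (Z \<omega>))\<^sup>2 \<partial>M) \<le> c * e" and "0 < c"
  shows "measure (distr M borel Z) {x. norm x > sqrt c} \<le> e"
proof -
  interpret prob_space M by fact
  have "measure (distr M borel Z) {x. norm x > sqrt c} = prob (Z -` {x. norm x > sqrt c} \<inter> space M)"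
    by (rule measure_distr[OF Z]) simp
  also have "\<dots> \<le> prob {\<omega> \<in> space M. (norm (Z \<omega>))\<^sup>2 \<ge> c}"
  proof (rule finite_measure_mono)
    show "Z -` {x. norm x > sqrt c} \<inter> space M \<subseteq> {\<omega> \<in> space M. (norm (Z \<omega>))\<^sup>2 \<ge> c}"
      using \<open>0 < c\<close> by (auto simp: real_sqrt_le_iff intro: sqrt_le_D less_imp_le)
    show "{\<omega> \<in> space M. (norm (Z \<omega>))\<^sup>2 \<ge> c} \<in> events"
      using Z by measurable
  qed
  also have "\<dots> \<le> (\<integral>\<omega>. (norm (Z \<omega>))\<^sup>2 \<partial>M) / c"
    using integral_Markov_inequality_measure[OF int, of "{}" c] \<open>0 < c\<close> by simp
  also have "\<dots> \<le> e" using le \<open>0 < c\<close> by (simp add: divide_le_eq mult.commute)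
  finally show ?thesis .
qed

theorem theorem2p1:
  fixes P :: "nat \<Rightarrow> 'a measure"
    and X Y :: "nat \<Rightarrow> 'a \<Rightarrow> nat"
    and M :: "nat \<Rightarrow> nat"
    and \<alpha>n \<beta>n \<gamma>n s :: "nat \<Rightarrow> real"
    and \<alpha> \<beta> \<gamma> :: real
    and An :: "nat \<Rightarrow> real ^ 2 ^ 2"
    and A :: "real ^ 2 ^ 2"
  assumes prob: "\<And>n. n \<ge> 1 \<Longrightarrow> prob_space (P n)"
    and X_rv: "\<And>n. n \<ge> 1 \<Longrightarrow> X n \<in> measurable (P n) (count_space UNIV)"
    and Y_rv: "\<And>n. n \<ge> 1 \<Longrightarrow> Y n \<in> measurable (P n) (count_space UNIV)"
    and X_bdd: "\<And>n. n \<ge> 1 \<Longrightarrow> bdd_above (X n ` space (P n))"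
    and Y_bdd: "\<And>n. n \<ge> 1 \<Longrightarrow> bdd_above (Y n ` space (P n))"
    and stable: "\<And>n. n \<ge> 1 \<Longrightarrow> real_stable2 (prob_gen_poly (P n) (X n) (Y n))"
    and deg_x: "\<And>n. n \<ge> 1 \<Longrightarrow> degree (prob_gen_poly (P n) (X n) (Y n)) \<le> M n"
    and deg_y: "\<And>n. n \<ge> 1 \<Longrightarrow> degree_y (prob_gen_poly (P n) (X n) (Y n)) \<le> M n"
    and An_eq: "\<And>n. n \<ge> 1 \<Longrightarrow>
          An n = vector [vector [\<alpha>n n, - \<beta>n n], vector [- \<beta>n n, \<gamma>n n]]"
    and cov: "\<And>n. n \<ge> 1 \<Longrightarrow>
          covariance_matrix (P n) (\<lambda>\<omega>. vector [real (X n \<omega>), real (Y n \<omega>)]) = An n"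
    and A_eq: "A = vector [vector [\<alpha>, - \<beta>], vector [- \<beta>, \<gamma>]]"
    and s_lim: "filterlim s at_top sequentially"
    and A_lim: "(\<lambda>n. inverse ((s n)\<^sup>2) *\<^sub>R An n) \<longlonglongrightarrow> A"
    and M_lim: "(\<lambda>n. inverse (s n) * root 3 (real (M n))) \<longlonglongrightarrow> 0"
  shows "converges_in_distribution P
      (\<lambda>n \<omega>. inverse (s n) *\<^sub>R
        (vector [real (X n \<omega>), real (Y n \<omega>)]
          - vector [\<integral>\<omega>'. real (X n \<omega>') \<partial>P n, \<integral>\<omega>'. real (Y n \<omega>') \<partial>P n] :: real ^ 2))
      (centered_gaussian A)"
proof -
  \<comment> \<open>The hypotheses start at index 1, so everything is shifted to
    \<open>Suc n\<close>; \<open>LIMSEQ_imp_Suc\<close> undoes the shift at the end.\<close>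
  define \<sigma> where "\<sigma> = (\<lambda>n. s (Suc n))"
  define m1 where "m1 = (\<lambda>n. \<integral>\<omega>. real (X (Suc n) \<omega>) \<partial>P (Suc n))"
  define m2 where "m2 = (\<lambda>n. \<integral>\<omega>. real (Y (Suc n) \<omega>) \<partial>P (Suc n))"
  define W where "W = (\<lambda>n a b \<omega>. a * (real (X (Suc n) \<omega>) - m1 n) + b * (real (Y (Suc n) \<omega>) - m2 n))"
  define Z where "Z = (\<lambda>n \<omega>. inverse (\<sigma> n) *\<^sub>R
    (vector [real (X (Suc n) \<omega>), real (Y (Suc n) \<omega>)] - vector [m1 n, m2 n] :: real ^ 2))"
  define q where "q = (\<lambda>a b. \<alpha> * a\<^sup>2 - 2 * \<beta> * a * b + \<gamma> * b\<^sup>2)"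

  have prob': "prob_space (P (Suc n))" for n by (rule prob) simp
  have X_rv': "X (Suc n) \<in> measurable (P (Suc n)) (count_space UNIV)"
    and Y_rv': "Y (Suc n) \<in> measurable (P (Suc n)) (count_space UNIV)" for n
    using X_rv Y_rv by simp_all
  have fin: "finite (X (Suc n) ` space (P (Suc n)))" "finite (Y (Suc n) ` space (P (Suc n)))" for n
    using X_bdd[of "Suc n"] Y_bdd[of "Suc n"] by (simp_all add: bdd_above_nat)
  note pair = X_rv' Y_rv' fin
  have integrable: "integrable (P (Suc n)) (\<lambda>\<omega>. h (X (Suc n) \<omega>) (Y (Suc n) \<omega>))"
    for n and h :: "nat \<Rightarrow> nat \<Rightarrow> real"
    by (rule prob_space.integrable_finite_pair[OF prob' pair])

  \<comment> \<open>Second moments of linear forms and their limits\<close>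
  have cov_entry: "covariance_matrix (P (Suc n)) (\<lambda>\<omega>. vector [real (X (Suc n) \<omega>), real (Y (Suc n) \<omega>)]) $ i $ j
      = (vector [vector [\<alpha>n (Suc n), - \<beta>n (Suc n)], vector [- \<beta>n (Suc n), \<gamma>n (Suc n)]] :: real ^ 2 ^ 2) $ i $ j"
    for n i j using cov[of "Suc n"] An_eq[of "Suc n"] by simp
  have var: "(\<integral>\<omega>. (W n a b \<omega>)\<^sup>2 \<partial>P (Suc n))
      = \<alpha>n (Suc n) * a\<^sup>2 - 2 * \<beta>n (Suc n) * a * b + \<gamma>n (Suc n) * b\<^sup>2" for n a b
  proof -
    let ?x = "\<lambda>\<omega>. real (X (Suc n) \<omega>) - m1 n" and ?y = "\<lambda>\<omega>. real (Y (Suc n) \<omega>) - m2 n"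
    have entries: "(\<integral>\<omega>. ?x \<omega> * ?x \<omega> \<partial>P (Suc n)) = \<alpha>n (Suc n)"
      "(\<integral>\<omega>. ?x \<omega> * ?y \<omega> \<partial>P (Suc n)) = - \<beta>n (Suc n)"
      "(\<integral>\<omega>. ?y \<omega> * ?y \<omega> \<partial>P (Suc n)) = \<gamma>n (Suc n)"
      using cov_entry[of n 1 1] cov_entry[of n 1 2] cov_entry[of n 2 2]
      by (simp_all add: covariance_matrix_def m1_def m2_def)
    have ints: "integrable (P (Suc n)) (\<lambda>\<omega>. ?x \<omega> * ?x \<omega>)" "integrable (P (Suc n)) (\<lambda>\<omega>. ?x \<omega> * ?y \<omega>)"
      "integrable (P (Suc n)) (\<lambda>\<omega>. ?y \<omega> * ?y \<omega>)"
      by (rule integrable[of n "\<lambda>r _. (real r - m1 n) * (real r - m1 n)"]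
        integrable[of n "\<lambda>r t. (real r - m1 n) * (real t - m2 n)"]
        integrable[of n "\<lambda>_ t. (real t - m2 n) * (real t - m2 n)"])+
    have "(W n a b \<omega>)\<^sup>2 = a\<^sup>2 * (?x \<omega> * ?x \<omega>) + 2 * a * b * (?x \<omega> * ?y \<omega>) + b\<^sup>2 * (?y \<omega> * ?y \<omega>)" for \<omega>
      by (simp add: W_def power2_eq_square algebra_simps)
    then have "(\<integral>\<omega>. (W n a b \<omega>)\<^sup>2 \<partial>P (Suc n))
        = a\<^sup>2 * (\<integral>\<omega>. ?x \<omega> * ?x \<omega> \<partial>P (Suc n)) + 2 * a * b * (\<integral>\<omega>. ?x \<omega> * ?y \<omega> \<partial>P (Suc n))
          + b\<^sup>2 * (\<integral>\<omega>. ?y \<omega> * ?y \<omega> \<partial>P (Suc n))"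
      using ints by (simp only:) simp
    then show ?thesis by (simp only: entries) (simp add: algebra_simps)
  qed

  have A_lim': "(\<lambda>n. inverse ((\<sigma> n)\<^sup>2) * An (Suc n) $ i $ j) \<longlonglongrightarrow> A $ i $ j" for i j
    using tendsto_vec_nth[OF tendsto_vec_nth[OF LIMSEQ_Suc[OF A_lim], of i], of j]
    by (simp add: \<sigma>_def)
  have \<alpha>_lim: "(\<lambda>n. \<alpha>n (Suc n) / (\<sigma> n)\<^sup>2) \<longlonglongrightarrow> \<alpha>"
    and \<beta>_lim: "(\<lambda>n. \<beta>n (Suc n) / (\<sigma> n)\<^sup>2) \<longlonglongrightarrow> \<beta>"
    and \<gamma>_lim: "(\<lambda>n. \<gamma>n (Suc n) / (\<sigma> n)\<^sup>2) \<longlonglongrightarrow> \<gamma>"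
    using A_lim'[of 1 1] tendsto_minus[OF A_lim'[of 1 2]] A_lim'[of 2 2]
    by (simp_all add: An_eq A_eq field_simps)
  have q_lim: "(\<lambda>n. (\<integral>\<omega>. (W n a b \<omega>)\<^sup>2 \<partial>P (Suc n)) / (\<sigma> n)\<^sup>2) \<longlonglongrightarrow> q a b" for a b
  proof -
    have "(\<lambda>n. \<alpha>n (Suc n) / (\<sigma> n)\<^sup>2 * a\<^sup>2 - 2 * (\<beta>n (Suc n) / (\<sigma> n)\<^sup>2) * a * b + \<gamma>n (Suc n) / (\<sigma> n)\<^sup>2 * b\<^sup>2)
        \<longlonglongrightarrow> q a b"
      unfolding q_def by (intro tendsto_intros \<alpha>_lim \<beta>_lim \<gamma>_lim)
    then show ?thesis by (simp add: var add_divide_distrib diff_divide_distrib)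
  qed
  \<comment> \<open>The form of \<open>A\<close> is a limit of normalised variances; this is the
    source of its positive semidefiniteness.\<close>
  have q_nonneg: "0 \<le> q a b" for a b
    by (rule LIMSEQ_le_const[OF q_lim]) (auto intro!: divide_nonneg_nonneg integral_nonneg)

  have \<sigma>_inv: "(\<lambda>n. inverse (\<sigma> n)) \<longlonglongrightarrow> 0"
    unfolding \<sigma>_def by (rule LIMSEQ_Suc[OF tendsto_inverse_0_at_top[OF s_lim]])
  \<comment> \<open>The cube of \<open>M_lim\<close>, with the added 1 absorbed by
    \<open>\<sigma>_inv\<close>. Absolute values allow for initial terms of \<open>s\<close> that
    are not positive.\<close>
  have M_lim': "(\<lambda>n. (real (M (Suc n)) + 1) * \<bar>inverse (\<sigma> n)\<bar> ^ 3) \<longlonglongrightarrow> 0"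
  proof -
    have "(\<lambda>n. \<bar>inverse (\<sigma> n) * root 3 (real (M (Suc n)))\<bar> ^ 3 + \<bar>inverse (\<sigma> n)\<bar> ^ 3) \<longlonglongrightarrow> \<bar>0\<bar> ^ 3 + \<bar>0\<bar> ^ 3"
      unfolding \<sigma>_def by (intro tendsto_intros LIMSEQ_Suc[OF M_lim] \<sigma>_inv[unfolded \<sigma>_def])
    moreover have "\<bar>inverse (\<sigma> n) * root 3 (real (M (Suc n)))\<bar> ^ 3 + \<bar>inverse (\<sigma> n)\<bar> ^ 3
        = (real (M (Suc n)) + 1) * \<bar>inverse (\<sigma> n)\<bar> ^ 3" for n
      by (simp add: abs_mult power_mult_distrib distrib_right)
    ultimately show ?thesis by simp
  qed

  \<comment> \<open>Moment generating functions in positive directions\<close>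
  have mgf: "(\<lambda>n. \<integral>\<omega>. exp (z / of_real (\<sigma> n) * of_real (W n a b \<omega>)) \<partial>P (Suc n))
      \<longlonglongrightarrow> exp (of_real (q a b) * z\<^sup>2 / 2)" if ab: "0 < a" "0 < b" for a b and z :: complex
  proof -
    let ?u = "\<lambda>n. z / complex_of_real (\<sigma> n)"
    let ?v = "\<lambda>n. (\<integral>\<omega>. (W n a b \<omega>)\<^sup>2 \<partial>P (Suc n))"
    have u_norm: "norm (?u n) = norm z * \<bar>inverse (\<sigma> n)\<bar>" for n
      by (simp add: divide_inverse norm_mult norm_inverse)
    \<comment> \<open>Keeping the smallness condition inside the existential lets one sequence
      \<open>d\<close> be chosen for all \<open>n\<close>, although the expansion holds only
      eventually.\<close>
    have "\<exists>d. 4 * (a + b) * norm (?u n) \<le> 1 \<longrightarrow>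
        (\<integral>\<omega>. exp (?u n * of_real (W n a b \<omega>)) \<partial>P (Suc n)) = exp (of_real (?v n) * (?u n)\<^sup>2 / 2 + d)
        \<and> norm d \<le> 384 * (real (M (Suc n)) + 1) * ((a + b) * norm (?u n)) ^ 3" for n
      using prob_space.stable_pair_mgf[OF prob' pair, of n "M (Suc n)" a b "?u n"]
        stable[of "Suc n"] deg_x[of "Suc n"] deg_y[of "Suc n"] ab
      unfolding W_def m1_def m2_def by auto
    then obtain d where d: "\<And>n. 4 * (a + b) * norm (?u n) \<le> 1 \<Longrightarrow>
        (\<integral>\<omega>. exp (?u n * of_real (W n a b \<omega>)) \<partial>P (Suc n)) = exp (of_real (?v n) * (?u n)\<^sup>2 / 2 + d n)
        \<and> norm (d n) \<le> 384 * (real (M (Suc n)) + 1) * ((a + b) * norm (?u n)) ^ 3"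
      by metis
    have "(\<lambda>n. 4 * (a + b) * (norm z * \<bar>inverse (\<sigma> n)\<bar>)) \<longlonglongrightarrow> 4 * (a + b) * (norm z * \<bar>0\<bar>)"
      by (intro tendsto_intros \<sigma>_inv)
    then have "\<forall>\<^sub>F n in sequentially. 4 * (a + b) * (norm z * \<bar>inverse (\<sigma> n)\<bar>) < 1"
      by (rule order_tendstoD) simp
    then have small: "\<forall>\<^sub>F n in sequentially. 4 * (a + b) * norm (?u n) \<le> 1"
      by eventually_elim (simp only: u_norm less_imp_le)
    have "d \<longlonglongrightarrow> 0"
    proof (rule Lim_null_comparison)
      show "\<forall>\<^sub>F n in sequentially. norm (d n)
          \<le> 384 * ((a + b) * norm z) ^ 3 * ((real (M (Suc n)) + 1) * \<bar>inverse (\<sigma> n)\<bar> ^ 3)"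
        using small
      proof eventually_elim
        case (elim n)
        then have "norm (d n) \<le> 384 * (real (M (Suc n)) + 1) * ((a + b) * (norm z * \<bar>inverse (\<sigma> n)\<bar>)) ^ 3"
          using d[of n] by (simp only: u_norm)
        also have "\<dots> = 384 * ((a + b) * norm z) ^ 3 * ((real (M (Suc n)) + 1) * \<bar>inverse (\<sigma> n)\<bar> ^ 3)"
          by (simp only: power_mult_distrib mult_ac)
        finally show ?case .
      qed
      show "(\<lambda>n. 384 * ((a + b) * norm z) ^ 3 * ((real (M (Suc n)) + 1) * \<bar>inverse (\<sigma> n)\<bar> ^ 3)) \<longlonglongrightarrow> 0"
        by (rule tendsto_mult_right_zero[OF M_lim'])
    qed
    then have "(\<lambda>n. exp (of_real (?v n / (\<sigma> n)\<^sup>2) * z\<^sup>2 / 2 + d n)) \<longlonglongrightarrow> exp (of_real (q a b) * z\<^sup>2 / 2 + 0)"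
      by (intro tendsto_intros q_lim) auto
    moreover have "\<forall>\<^sub>F n in sequentially. exp (of_real (?v n / (\<sigma> n)\<^sup>2) * z\<^sup>2 / 2 + d n)
        = (\<integral>\<omega>. exp (?u n * of_real (W n a b \<omega>)) \<partial>P (Suc n))"
      using small
    proof eventually_elim
      case (elim n)
      then show ?case using d[of n] by (simp add: power_divide)
    qed
    ultimately show ?thesis by (simp add: tendsto_cong)
  qed

  \<comment> \<open>Characteristic functions in all directions\<close>
  have Z_inner: "t \<bullet> Z n \<omega> = W n (t $ 1) (t $ 2) \<omega> / \<sigma> n" for t n \<omega>
    by (simp add: Z_def W_def inner_vec_def sum_2 divide_inverse algebra_simps)

  have char: "(\<lambda>n. \<integral>\<omega>. iexp (t \<bullet> Z n \<omega>) \<partial>P (Suc n)) \<longlonglongrightarrow> exp (- complex_of_real (q (t $ 1) (t $ 2)) / 2)"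
    for t :: "real ^ 2"
  proof -
    define I where "I = (\<lambda>n. X (Suc n) ` space (P (Suc n)) \<times> Y (Suc n) ` space (P (Suc n)))"
    define p where "p = (\<lambda>n (r, k). measure (P (Suc n)) {\<omega> \<in> space (P (Suc n)). X (Suc n) \<omega> = r \<and> Y (Suc n) \<omega> = k})"
    define x where "x = (\<lambda>n (r :: nat, k :: nat). (real r - m1 n) / \<sigma> n)"
    define y where "y = (\<lambda>n (r :: nat, k :: nat). (real k - m2 n) / \<sigma> n)"
    have F: "(\<integral>\<omega>. exp (z / of_real (\<sigma> n) * of_real (W n a b \<omega>)) \<partial>P (Suc n))
        = (\<Sum>i\<in>I n. complex_of_real (p n i) * exp (z * of_real a * of_real (x n i) + z * of_real b * of_real (y n i)))"
      for z :: complex and a b n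
      unfolding W_def
      by (subst prob_space.expectation_finite_pair[OF prob' pair,
            of n "\<lambda>r k. exp (z / of_real (\<sigma> n) * of_real (a * (real r - m1 n) + b * (real k - m2 n)))"])
         (simp add: I_def p_def x_def y_def case_prod_unfold scaleR_conv_of_real divide_inverse algebra_simps)
    \<comment> \<open>Homogeneity matches the two-variable limit required by the continuation lemma
      with the one-variable limit in \<open>mgf\<close>.\<close>
    have Q: "of_real \<alpha> * (z * of_real a)\<^sup>2 - 2 * of_real \<beta> * (z * of_real a) * (z * of_real b)
        + of_real \<gamma> * (z * of_real b)\<^sup>2 = of_real (q a b) * z\<^sup>2" for z :: complex and a b
      by (simp add: q_def power2_eq_square algebra_simps)
    have "(\<lambda>n. \<Sum>i\<in>I n. complex_of_real (p n i) *
        exp (\<i> * of_real (t $ 1) * of_real (x n i) + \<i> * of_real (t $ 2) * of_real (y n i)))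
      \<longlonglongrightarrow> exp ((of_real \<alpha> * (\<i> * of_real (t $ 1))\<^sup>2 - 2 * of_real \<beta> * (\<i> * of_real (t $ 1)) * (\<i> * of_real (t $ 2))
        + of_real \<gamma> * (\<i> * of_real (t $ 2))\<^sup>2) / 2)"
    proof (rule char_tendsto_of_positive_quadrant)
      show "0 \<le> p n i" for n i by (simp add: p_def case_prod_unfold)
    qed (unfold Q F[symmetric], rule mgf)
    then have "(\<lambda>n. \<integral>\<omega>. exp (\<i> / of_real (\<sigma> n) * of_real (W n (t $ 1) (t $ 2) \<omega>)) \<partial>P (Suc n))
        \<longlonglongrightarrow> exp (of_real (q (t $ 1) (t $ 2)) * \<i>\<^sup>2 / 2)"
      unfolding Q F .
    then show ?thesis by (simp add: Z_inner)
  qed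

  \<comment> \<open>Measurability and tightness\<close>
  have Z_meas: "Z n \<in> borel_measurable (P (Suc n))" for n
  proof -
    have "(\<lambda>\<omega>. real (X (Suc n) \<omega>)) \<in> borel_measurable (P (Suc n))"
      "(\<lambda>\<omega>. real (Y (Suc n) \<omega>)) \<in> borel_measurable (P (Suc n))"
      using X_rv' Y_rv' by measurable
    then show ?thesis unfolding Z_def
      by (intro borel_measurable_scaleR borel_measurable_diff borel_measurable_vector_2
          borel_measurable_const)
  qed
  have Z_norm: "(norm (Z n \<omega>))\<^sup>2 = ((W n 1 0 \<omega>)\<^sup>2 + (W n 0 1 \<omega>)\<^sup>2) / (\<sigma> n)\<^sup>2" for n \<omega>
    unfolding power2_norm_eq_inner
    by (simp add: inner_vec_def sum_2 Z_def W_def power2_eq_square divide_inverse algebra_simps)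
  have W_int: "integrable (P (Suc n)) (\<lambda>\<omega>. (W n a b \<omega>)\<^sup>2)" for n a b
    unfolding W_def by (rule integrable[of n "\<lambda>r k. (a * (real r - m1 n) + b * (real k - m2 n))\<^sup>2"])
  \<comment> \<open>The coordinate directions (1, 0) and (0, 1) lie outside the open quadrant of
    \<open>mgf\<close>, but \<open>q_lim\<close> covers every direction.\<close>
  have "(\<lambda>n. \<integral>\<omega>. (norm (Z n \<omega>))\<^sup>2 \<partial>P (Suc n)) \<longlonglongrightarrow> q 1 0 + q 0 1"
    using tendsto_add[OF q_lim[of 1 0] q_lim[of 0 1]] W_int
    by (simp add: Z_norm add_divide_distrib)
  then have "Bseq (\<lambda>n. \<integral>\<omega>. (norm (Z n \<omega>))\<^sup>2 \<partial>P (Suc n))"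
    by (intro convergent_imp_Bseq convergentI)
  then obtain C where C: "0 < C" "\<And>n. norm (\<integral>\<omega>. (norm (Z n \<omega>))\<^sup>2 \<partial>P (Suc n)) \<le> C"
    unfolding Bseq_def by blast

  obtain B :: "real ^ 2 ^ 2" where B: "B ** transpose B = A"
  proof -
    \<comment> \<open>Needed because \<open>centered_gaussian\<close> chooses its factor by
      \<open>SOME\<close>; the Cholesky lemma is applied with off-diagonal entry
      \<open>- \<beta>\<close>.\<close>
    have "\<exists>B :: real ^ 2 ^ 2. B ** transpose B = A"
      unfolding A_eq using psd_2x2_det_nonneg[of \<alpha> \<beta> \<gamma>] q_nonneg
      by (intro psd_2x2_factor) (simp_all add: q_def)
    then show ?thesis using that by blast
  qed
  have A_inner: "t \<bullet> (A *v t) = q (t $ 1) (t $ 2)" for t :: "real ^ 2"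
    by (simp add: A_eq q_def inner_vec_def matrix_vector_mult_def sum_2 power2_eq_square algebra_simps)

  have "weak_converges (\<lambda>n. distr (P (Suc n)) borel (Z n)) (centered_gaussian A)"
  proof (rule weak_converges_char)
    show "prob_space (distr (P (Suc n)) borel (Z n))" for n
      by (rule prob_space.prob_space_distr[OF prob' Z_meas])
    show "\<exists>K. \<forall>n. measure (distr (P (Suc n)) borel (Z n)) {x. norm x > K} \<le> e" if "0 < e" for e
    proof (intro exI[of _ "sqrt (C / e)"] allI prob_norm_gt_le[OF prob' Z_meas])
      show "integrable (P (Suc n)) (\<lambda>\<omega>. (norm (Z n \<omega>))\<^sup>2)" for n
        using W_int by (simp add: Z_norm)
      show "(\<integral>\<omega>. (norm (Z n \<omega>))\<^sup>2 \<partial>P (Suc n)) \<le> C / e * e" for n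
        using C(2)[of n] \<open>0 < e\<close> by simp
    qed (use C(1) \<open>0 < e\<close> in simp)
    show "(\<lambda>n. \<integral>x. iexp (t \<bullet> x) \<partial>distr (P (Suc n)) borel (Z n)) \<longlonglongrightarrow> (\<integral>x. iexp (t \<bullet> x) \<partial>centered_gaussian A)" for t
    proof -
      have "(\<integral>x. iexp (t \<bullet> x) \<partial>distr (P (Suc n)) borel (Z n)) = (\<integral>\<omega>. iexp (t \<bullet> Z n \<omega>) \<partial>P (Suc n))" for n
        by (rule integral_distr[OF Z_meas]) measurable
      then show ?thesis
        using char[of t] by (simp only: char_centered_gaussian[OF B] A_inner)
    qed
  qed (simp_all add: prob_space_centered_gaussian sets_centered_gaussian)
  then show ?thesis
    unfolding converges_in_distribution_def weak_converges_def Z_def \<sigma>_def m1_def m2_def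
    by (auto intro: LIMSEQ_imp_Suc)
qed

end
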